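(* For every integer $\ell \geq 2$ we have $$\Omega \big( \mathrm{ex}(n,\{C_4,C_6,\dots,C_{2\ell}\}) \big) \leq \mathrm{ex}(n,C_3,C_{2\ell}) \leq O_{\ell}\big( \mathrm{ex}(n,C_{2\ell}) \big).$$ Here the constant implicit in $\Omega$ is absolute and the constant implicit in $O_\ell$ depends only on $\ell$.
   Context: Graphs are finite and simple. $C_k$ denotes the cycle of length $k$. $\mathrm{ex}(n,C_3,C_{2\ell})$ is the maximum number of (unlabeled) copies of $C_3$ in an $n$-vertex graph containing no copy of $C_{2\ell}$ as a (not necessarily induced) subgraph. $\mathrm{ex}(n,C_{2\ell})$ is the maximum number of edges in an $n$-vertex graph containing no copy of $C_{2\ell}$. $\mathrm{ex}(n,\{C_4,C_6,\dots,C_{2\ell}\})$ is the maximum number of edges in an $n$-vertex graph with no copy of $C_{2t}$ for any $2\le t\le \ell$. The upper bound is for all $n\ge 1$; the lower bound is for all $n$ sufficiently large (the threshold may depend on $\ell$). *)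

theory Defs
  imports Complex_Main
begin

type_synonym 'a graph = "'a set \<times> 'a set set"

abbreviation verts :: "'a graph \<Rightarrow> 'a set" where "verts \<equiv> fst"
abbreviation edges :: "'a graph \<Rightarrow> 'a set set" where "edges \<equiv> snd"

definition simple_graph :: "'a graph \<Rightarrow> bool" where
  "simple_graph G \<longleftrightarrow> finite (verts G) \<and> (\<forall>e\<in>edges G. e \<subseteq> verts G \<and> card e = 2)"

definition graph_iso :: "'a graph \<Rightarrow> 'b graph \<Rightarrow> bool" where
  "graph_iso G H \<longleftrightarrow> (\<exists>f. bij_betw f (verts G) (verts H) \<and> edges H = (`) f ` edges G)"

definition subgraph :: "'a graph \<Rightarrow> 'a graph \<Rightarrow> bool" where
  "subgraph S G \<longleftrightarrow> simple_graph S \<and> verts S \<subseteq> verts G \<and> edges S \<subseteq> edges G"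

(* Unlabelled copies: (not necessarily induced) subgraphs of G isomorphic to H,
   not embeddings of H into G. *)
definition copies :: "'b graph \<Rightarrow> 'a graph \<Rightarrow> 'a graph set" where
  "copies H G = {S. subgraph S G \<and> graph_iso S H}"

definition free_of :: "'b graph set \<Rightarrow> 'a graph \<Rightarrow> bool" where
  "free_of \<F> G \<longleftrightarrow> (\<forall>F\<in>\<F>. copies F G = {})"

(* The cycle of length k for k \<ge> 3; smaller k give degenerate values. *)
definition cycle_graph :: "nat \<Rightarrow> nat graph" where
  "cycle_graph k = ({..<k}, {{i, (i + 1) mod k} | i. i < k})"

(* All n-vertex graphs with natural-number vertices; every finite graph is
   isomorphic to one of these. *)
definition free_graphs :: "nat \<Rightarrow> 'b graph set \<Rightarrow> nat graph set" where
  "free_graphs n \<F> = {G. simple_graph G \<and> card (verts G) = n \<and> free_of \<F> G}"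

definition ex_edges :: "nat \<Rightarrow> 'b graph set \<Rightarrow> nat" where
  "ex_edges n \<F> = Max ((\<lambda>G. card (edges G)) ` free_graphs n \<F>)"

definition ex_copies :: "nat \<Rightarrow> 'c graph \<Rightarrow> 'b graph set \<Rightarrow> nat" where
  "ex_copies n H \<F> = Max ((\<lambda>G. card (copies H G)) ` free_graphs n \<F>)"

(* The facts below show that both maxima range over finite sets, which are
   nonempty as soon as every forbidden graph has an edge. *)

lemma finite_edges:
  assumes "simple_graph G"
  shows "finite (edges G)" "card (edges G) \<le> 2 ^ card (verts G)"
proof -
  have sub: "edges G \<subseteq> Pow (verts G)" and fin: "finite (verts G)"
    using assms by (auto simp: simple_graph_def)
  show "finite (edges G)"
    using sub fin by (meson finite_Pow_iff finite_subset)
  show "card (edges G) \<le> 2 ^ card (verts G)"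
    using card_mono[OF _ sub] fin by (simp add: card_Pow)
qed

lemma finite_copies:
  assumes "simple_graph G"
  shows "finite (copies H G)"
    and "card (copies H G) \<le> 2 ^ card (verts G) * 2 ^ (2 ^ card (verts G))"
proof -
  have sub: "copies H G \<subseteq> Pow (verts G) \<times> Pow (edges G)"
    by (auto simp: copies_def subgraph_def)
  have fin: "finite (verts G)"
    using assms by (simp add: simple_graph_def)
  have finP: "finite (Pow (verts G) \<times> Pow (edges G))"
    using fin finite_edges(1)[OF assms] by simp
  show "finite (copies H G)"
    using sub finP by (rule finite_subset)
  have "card (copies H G) \<le> card (Pow (verts G) \<times> Pow (edges G))"
    using finP sub by (rule card_mono)
  also have "\<dots> = 2 ^ card (verts G) * 2 ^ card (edges G)"
    using fin finite_edges(1)[OF assms] by (simp add: card_cartesian_product card_Pow)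
  also have "\<dots> \<le> 2 ^ card (verts G) * 2 ^ (2 ^ card (verts G))"
    using finite_edges(2)[OF assms] by simp
  finally show "card (copies H G) \<le> 2 ^ card (verts G) * 2 ^ (2 ^ card (verts G))" .
qed

lemma finite_edge_counts: "finite ((\<lambda>G. card (edges G)) ` free_graphs n \<F>)"
proof (rule finite_subset)
  show "(\<lambda>G. card (edges G)) ` free_graphs n \<F> \<subseteq> {..2 ^ n}"
    using finite_edges(2) by (auto simp: free_graphs_def)
qed simp

lemma finite_copy_counts: "finite ((\<lambda>G. card (copies H G)) ` free_graphs n \<F>)"
proof (rule finite_subset)
  show "(\<lambda>G. card (copies H G)) ` free_graphs n \<F> \<subseteq> {..2 ^ n * 2 ^ (2 ^ n)}"
    using finite_copies(2) by (fastforce simp: free_graphs_def)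
qed simp

lemma free_graphs_nonempty:
  assumes "\<And>F. F \<in> \<F> \<Longrightarrow> edges F \<noteq> {}"
  shows "free_graphs n \<F> \<noteq> {}"
proof -
  have "({..<n}, {}) \<in> free_graphs n \<F>"
    using assms
    by (auto simp: free_graphs_def simple_graph_def free_of_def copies_def subgraph_def
        graph_iso_def)
  then show ?thesis by blast
qed

lemma edges_cycle_graph_nonempty: "k > 0 \<Longrightarrow> edges (cycle_graph k) \<noteq> {}"
  by (auto simp: cycle_graph_def)

lemma simple_cycle_graph:
  assumes "k \<ge> 3"
  shows "simple_graph (cycle_graph k)"
proof -
  have "i \<noteq> (i + 1) mod k" if "i < k" for i
    using that assms by (cases "i + 1 = k") auto
  then show ?thesis
    using assms by (auto simp: simple_graph_def cycle_graph_def card_insert_if)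
qed

end

theory Submission
  imports Defs "HOL-Algebra.Algebraic_Closure_Type" "HOL-Library.Z2"
begin

text \<open>
  Upper bound: if every edge of a graph lies in at least k triangles, then a cycle of length
  j < k extends to one of length j + 1 by replacing one of its edges with a path of length two
  through a new vertex. So a graph without a cycle of length 2l always has an edge in
  fewer than 2l triangles, and deleting such edges one at a time gives at most 2l triangles
  per edge.

  Lower bound for l > 2: an extremal graph for the family of short even cycles has a bipartite
  subgraph, with parts A and B, that keeps a constant fraction of the edges and leaves room to
  replace every vertex of B by two adjacent copies of it. Every edge then becomes a triangle. The
  trace in A and B of a cycle of length 2l > 4 in the new graph, with those vertices of A removed
  whose two neighbours on the cycle are copies of the same vertex, has minimum degree two,
  hence contains an even cycle, which is too short to exist.

  For l = 2 the blown-up edges would create copies of the cycle of length 4. Here both sides have order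
  n^(3/2): counting paths of length two bounds the edges, and the graph on pairs over a field
  of order q = 2^k, with (a, b) adjacent to (c, d) iff b + d = ac, has about q^3 / 6 triangles.
\<close>

subsection \<open>Cycles and triangles\<close>

abbreviation adj :: "'a graph \<Rightarrow> 'a \<Rightarrow> 'a \<Rightarrow> bool" where
  "adj G x y \<equiv> {x, y} \<in> edges G"

text \<open>Cycles are vertex lists over an arbitrary relation, so that the same notion serves
  graphs, blow-ups and traces. The bound \<open>length p \<ge> 3\<close> excludes going back and
  forth along one edge.\<close>

definition is_cycle :: "('a \<Rightarrow> 'a \<Rightarrow> bool) \<Rightarrow> 'a list \<Rightarrow> bool" where
  "is_cycle R p \<longleftrightarrow> distinct p \<and> length p \<ge> 3 \<and>
     (\<forall>i<length p. R (p ! i) (p ! ((i + 1) mod length p)))"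

lemma is_cycle_iff_successively:
  "is_cycle R p \<longleftrightarrow>
    distinct p \<and> length p \<ge> 3 \<and> successively R p \<and> R (last p) (hd p)"
proof (cases "length p \<ge> 3")
  case True
  then have ne: "p \<noteq> []" by auto
  have "(\<forall>i<length p. R (p ! i) (p ! ((i + 1) mod length p))) \<longleftrightarrow>
    (\<forall>i. Suc i < length p \<longrightarrow> R (p ! i) (p ! Suc i)) \<and> R (last p) (hd p)" (is "?l \<longleftrightarrow> ?r")
  proof
    assume l: ?l
    have "R (p ! i) (p ! Suc i)" if "Suc i < length p" for i
      using l[rule_format, of i] that by simp
    moreover have "R (last p) (hd p)"
      using l[rule_format, of "length p - 1"] ne by (simp add: last_conv_nth hd_conv_nth)
    ultimately show ?r by blast
  next
    assume r: ?r
    show ?l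
    proof (intro allI impI)
      fix i assume "i < length p"
      then consider "Suc i < length p" | "i = length p - 1" "Suc i = length p" by linarith
      then show "R (p ! i) (p ! ((i + 1) mod length p))"
        using r ne by cases (simp_all add: last_conv_nth hd_conv_nth)
    qed
  qed
  then show ?thesis
    by (auto simp: is_cycle_def successively_conv_nth)
qed (simp add: is_cycle_def)

lemma is_cycle_snoc:
  assumes "is_cycle R p" "z \<notin> set p" "R (last p) z" "R z (hd p)"
  shows "is_cycle R (p @ [z])"
proof -
  have "p \<noteq> []" using assms(1) by (auto simp: is_cycle_def)
  then show ?thesis
    using assms by (auto simp: is_cycle_iff_successively successively_append_iff)
qed

lemma is_cycle_mono:
  assumes "is_cycle R p" "\<And>x y. R x y \<Longrightarrow> R' x y"
  shows "is_cycle R' p"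
  using assms unfolding is_cycle_def by blast

lemma is_cycle_map:
  assumes "is_cycle R p" "inj_on f (set p)"
    "\<And>x y. x \<in> set p \<Longrightarrow> y \<in> set p \<Longrightarrow> R x y \<Longrightarrow> R' (f x) (f y)"
  shows "is_cycle R' (map f p)"
proof -
  have "R' (map f p ! i) (map f p ! ((i + 1) mod length p))" if "i < length p" for i
  proof -
    have "(i + 1) mod length p < length p" using that by (intro mod_less_divisor) linarith
    then show ?thesis using that assms(1,3) by (auto simp: is_cycle_def)
  qed
  then show ?thesis using assms(1,2) by (auto simp: is_cycle_def distinct_map)
qed

text \<open>Passage from subgraphs up to isomorphism to lists. The consecutive pairs of a cyclic
  list form a subgraph isomorphic to the cycle by taking positions; conversely, the inverse of an
  isomorphism lists the vertices of a copy in cyclic order.\<close>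

lemma copies_cycle_graph_empty_iff:
  assumes G: "simple_graph G" and k: "k \<ge> 3"
  shows "copies (cycle_graph k) G = {} \<longleftrightarrow> (\<nexists>p. is_cycle (adj G) p \<and> length p = k)"
proof -
  have "copies (cycle_graph k) G \<noteq> {}" if p: "is_cycle (adj G) p" "length p = k" for p
  proof -
    define E where "E = {{p ! i, p ! ((i + 1) mod k)} | i. i < k}"
    have lt: "(i + 1) mod k < k" for i using k by simp
    have bij: "bij_betw ((!) p) {..<k} (set p)"
      using p by (auto simp: is_cycle_def intro: bij_betw_nth)
    define f where "f = inv_into {..<k} ((!) p)"
    have f: "f (p ! i) = i" if "i < k" for i
      unfolding f_def using bij_betw_inv_into_left[OF bij] that by simp
    have E: "E \<subseteq> edges G" using p by (auto simp: E_def is_cycle_def)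
    have "set p \<subseteq> verts G"
    proof
      fix x assume "x \<in> set p"
      then obtain i where "i < k" "x = p ! i" using p by (auto simp: in_set_conv_nth)
      then have "{x, p ! ((i + 1) mod k)} \<in> edges G" using p by (auto simp: is_cycle_def)
      then show "x \<in> verts G" using G by (auto simp: simple_graph_def)
    qed
    moreover have "simple_graph (set p, E)"
      unfolding simple_graph_def
    proof (intro conjI ballI)
      fix e assume "e \<in> edges (set p, E)"
      then have e: "e \<in> E" by simp
      then show "e \<subseteq> verts (set p, E)" using p(2) lt by (auto simp: E_def)
      show "card e = 2" using e E G by (auto simp: simple_graph_def)
    qed simp
    ultimately have "subgraph (set p, E) G"
      using E by (simp add: subgraph_def)
    moreover have "graph_iso (set p, E) (cycle_graph k)"
      unfolding graph_iso_def
    proof (intro exI conjI)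
      show "bij_betw f (verts (set p, E)) (verts (cycle_graph k))"
        using bij_betw_inv_into[OF bij] by (simp add: f_def cycle_graph_def)
      have "f ` {p ! i, p ! ((i + 1) mod k)} = {i, (i + 1) mod k}" if "i < k" for i
        using f[OF that] f[OF lt] by simp
      then have "(`) f ` E = {{i, (i + 1) mod k} | i. i < k}"
        unfolding E_def by blast
      then show "edges (cycle_graph k) = (`) f ` edges (set p, E)"
        by (simp add: cycle_graph_def)
    qed
    ultimately show ?thesis by (auto simp: copies_def)
  qed
  moreover have "\<exists>p. is_cycle (adj G) p \<and> length p = k" if S: "S \<in> copies (cycle_graph k) G" for S
  proof -
    obtain f where f: "bij_betw f (verts S) {..<k}"
      and e: "{{i, (i + 1) mod k} | i. i < k} = (`) f ` edges S"
      using S by (auto simp: copies_def graph_iso_def cycle_graph_def)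
    have simp: "simple_graph S" and sub: "edges S \<subseteq> edges G"
      using S by (auto simp: copies_def subgraph_def)
    define g where "g = inv_into (verts S) f"
    have gf: "g (f x) = x" if "x \<in> verts S" for x
      using that f by (simp add: g_def bij_betw_inv_into_left)
    have adj: "{g i, g ((i + 1) mod k)} \<in> edges G" if "i < k" for i
    proof -
      have "{i, (i + 1) mod k} \<in> (`) f ` edges S" using that e by blast
      then obtain d where d: "d \<in> edges S" "{i, (i + 1) mod k} = f ` d" by blast
      then have "d \<subseteq> verts S" using simp by (auto simp: simple_graph_def)
      then have "g ` f ` d = d" using gf by (force simp: image_image)
      then have "d = {g i, g ((i + 1) mod k)}" using d(2) by (metis image_empty image_insert)
      then show ?thesis using d sub by auto
    qed
    have "inj_on g {..<k}" using bij_betw_inv_into[OF f] by (simp add: g_def bij_betw_def)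
    then have "distinct (map g [0..<k])" by (simp add: distinct_map atLeast0LessThan)
    moreover have "(i + 1) mod k < k" for i using k by simp
    ultimately have "is_cycle (adj G) (map g [0..<k])"
      unfolding is_cycle_def using adj k by (simp del: upt_conv_Cons upt_rec_numeral)
    moreover have "length (map g [0..<k]) = k" by simp
    ultimately show ?thesis by blast
  qed
  ultimately show ?thesis by blast
qed

section \<open>Unlabelled triangles as vertex sets\<close>

definition triangles :: "'a graph \<Rightarrow> 'a set set" where
  "triangles G = {T. T \<subseteq> verts G \<and> card T = 3 \<and> (\<forall>x\<in>T. \<forall>y\<in>T. x \<noteq> y \<longrightarrow> adj G x y)}"

lemma edges_cycle_graph_3: "edges (cycle_graph 3) = {e. e \<subseteq> {..<3} \<and> card e = 2}"
proof -
  have "{{i, (i + 1) mod 3} | i. i < (3::nat)} = (\<lambda>i. {i, (i + 1) mod 3}) ` {..<3}" by auto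
  also have "\<dots> = {{0, 1}, {1, 2}, {2, 0}}"
  proof -
    have "{..<3} = {0, 1, 2::nat}" by auto
    then show ?thesis by (simp add: numeral_2_eq_2)
  qed
  also have "\<dots> = {e. e \<subseteq> {..<3} \<and> card e = 2}"
  proof (intro equalityI subsetI)
    fix e :: "nat set" assume e: "e \<in> {e. e \<subseteq> {..<3} \<and> card e = 2}"
    then obtain x y where "e = {x, y}" "x \<noteq> y" by (auto simp: card_2_iff)
    moreover from this e have "x \<in> {0, 1, 2}" "y \<in> {0, 1, 2}" by auto
    ultimately show "e \<in> {{0, 1}, {1, 2}, {2, 0}}" by auto
  qed auto
  finally show ?thesis by (simp add: cycle_graph_def)
qed

text \<open>Since \<open>cycle_graph 3\<close> is complete, a copy of it contains all pairs of its
  three vertices. Hence a copy is determined by its vertex set, and \<open>verts\<close> is a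
  bijection from copies to \<open>triangles G\<close>.\<close>

lemma card_copies_triangle:
  assumes G: "simple_graph G"
  shows "card (copies (cycle_graph 3) G) = card (triangles G)"
proof -
  let ?P = "\<lambda>T. {e. e \<subseteq> T \<and> card e = 2}"
  have edges_S: "edges S = ?P (verts S)" and card_S: "card (verts S) = 3"
    if S: "S \<in> copies (cycle_graph 3) G" for S
  proof -
    obtain f where f: "bij_betw f (verts S) {..<3::nat}"
      and e: "?P {..<3} = (`) f ` edges S"
      using S unfolding copies_def graph_iso_def edges_cycle_graph_3
      by (auto simp: cycle_graph_def)
    have simp: "simple_graph S"
      using S by (auto simp: copies_def subgraph_def)
    show "card (verts S) = 3" using bij_betw_same_card[OF f] by simp
    show "edges S = ?P (verts S)"
    proof (intro equalityI subsetI)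
      fix d assume "d \<in> ?P (verts S)"
      then have d: "d \<subseteq> verts S" "card d = 2" by auto
      have "f ` d \<in> ?P {..<3}"
        using d f by (auto simp: bij_betw_def card_image inj_on_subset)
      then obtain d' where d': "d' \<in> edges S" "f ` d = f ` d'" using e by auto
      then have "d' \<subseteq> verts S" using simp by (auto simp: simple_graph_def)
      then have "d = d'" using d d' f by (metis bij_betw_def inj_on_image_eq_iff)
      then show "d \<in> edges S" using d' by simp
    qed (use simp in \<open>auto simp: simple_graph_def\<close>)
  qed
  have "bij_betw verts (copies (cycle_graph 3) G) (triangles G)"
    unfolding bij_betw_def
  proof (intro conjI equalityI subsetI)
    show "inj_on verts (copies (cycle_graph 3) G)"
      using edges_S by (intro inj_onI prod_eqI) auto
  next
    fix T assume "T \<in> verts ` copies (cycle_graph 3) G"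
    then obtain S where S: "S \<in> copies (cycle_graph 3) G" "T = verts S" by blast
    have "{x, y} \<in> edges G" if "x \<in> T" "y \<in> T" "x \<noteq> y" for x y
    proof -
      have "{x, y} \<in> edges S" using edges_S[OF S(1)] S(2) that by simp
      then show ?thesis using S(1) by (auto simp: copies_def subgraph_def)
    qed
    moreover have "T \<subseteq> verts G" using S by (auto simp: copies_def subgraph_def)
    ultimately show "T \<in> triangles G" using card_S S by (auto simp: triangles_def)
  next
    fix T assume T: "T \<in> triangles G"
    then have card: "card T = 3" by (simp add: triangles_def)
    then have fin: "finite T" using card.infinite by fastforce
    obtain f where f: "bij_betw f T {..<3::nat}"
      using ex_bij_betw_finite_nat[OF fin] card by (auto simp: atLeast0LessThan)
    have sub: "?P T \<subseteq> edges G"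
      using T by (auto simp: triangles_def card_2_iff)
    have "?P {..<3} \<subseteq> (`) f ` ?P T"
    proof
      fix d assume d: "d \<in> ?P {..<3::nat}"
      let ?g = "inv_into T f"
      have "f ` ?g ` d = d"
        using d bij_betw_inv_into_right[OF f] by (force simp: image_image)
      moreover have "?g ` d \<in> ?P T"
        using d bij_betw_inv_into[OF f] by (auto simp: bij_betw_def card_image inj_on_subset)
      ultimately show "d \<in> (`) f ` ?P T"
        by (intro rev_image_eqI[of "?g ` d"]) simp_all
    qed
    moreover have "(`) f ` ?P T \<subseteq> ?P {..<3}"
      using f by (auto simp: bij_betw_def card_image inj_on_subset)
    ultimately have "graph_iso (T, ?P T) (cycle_graph 3)"
      unfolding graph_iso_def edges_cycle_graph_3
      using f by (auto simp: cycle_graph_def)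
    moreover have "subgraph (T, ?P T) G"
      using sub T fin by (auto simp: subgraph_def simple_graph_def triangles_def)
    ultimately show "T \<in> verts ` copies (cycle_graph 3) G"
      by (force simp: copies_def)
  qed
  then show ?thesis by (rule bij_betw_same_card)
qed

lemma finite_triangles: "simple_graph G \<Longrightarrow> finite (triangles G)"
  by (rule finite_subset[of _ "Pow (verts G)"]) (auto simp: triangles_def simple_graph_def)

subsection \<open>The upper bound\<close>

lemma ex_edges_ge:
  "G \<in> free_graphs n \<F> \<Longrightarrow> card (edges G) \<le> ex_edges n \<F>"
  unfolding ex_edges_def by (intro Max_ge finite_edge_counts imageI)

lemma ex_copies_ge:
  "G \<in> free_graphs n \<F> \<Longrightarrow> card (copies H G) \<le> ex_copies n H \<F>"
  unfolding ex_copies_def by (intro Max_ge finite_copy_counts imageI)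

lemma ex_edges_attained:
  assumes "\<And>F. F \<in> \<F> \<Longrightarrow> edges F \<noteq> {}"
  obtains G where "G \<in> free_graphs n \<F>" "card (edges G) = ex_edges n \<F>"
proof -
  have "ex_edges n \<F> \<in> (\<lambda>G. card (edges G)) ` free_graphs n \<F>"
    unfolding ex_edges_def
    using free_graphs_nonempty[OF assms] by (intro Max_in finite_edge_counts) simp_all
  then show thesis using that by auto
qed

lemma ex_copies_attained:
  assumes "\<And>F. F \<in> \<F> \<Longrightarrow> edges F \<noteq> {}"
  obtains G where "G \<in> free_graphs n \<F>" "card (copies H G) = ex_copies n H \<F>"
proof -
  have "ex_copies n H \<F> \<in> (\<lambda>G. card (copies H G)) ` free_graphs n \<F>"
    unfolding ex_copies_def
    using free_graphs_nonempty[OF assms] by (intro Max_in finite_copy_counts) simp_all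
  then show thesis using that by auto
qed

lemma free_of_cycle_iff:
  assumes "simple_graph G" "k \<ge> 3"
  shows "free_of {cycle_graph k} G \<longleftrightarrow> (\<nexists>p. is_cycle (adj G) p \<and> length p = k)"
  using copies_cycle_graph_empty_iff[OF assms] by (simp add: free_of_def)

lemma triangles_le_ex_copies:
  fixes G :: "'a graph"
  assumes G: "simple_graph G" and n: "card (verts G) \<le> n" and k: "k \<ge> 3"
    and free: "\<nexists>p. is_cycle (adj G) p \<and> length p = k"
  shows "card (triangles G) \<le> ex_copies n (cycle_graph 3) {cycle_graph k}"
proof -
  have fin: "finite (verts G)" using G by (simp add: simple_graph_def)
  obtain f :: "'a \<Rightarrow> nat" where f: "inj_on f (verts G)" "f ` verts G \<subseteq> {..<n}"
    using card_le_inj[OF fin, of "{..<n}"] n by auto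
  define H where "H = ({..<n}, (`) f ` edges G)"
  have sub: "e \<subseteq> verts G" "card e = 2" if "e \<in> edges G" for e
    using G that by (auto simp: simple_graph_def)
  have H: "simple_graph H"
    unfolding simple_graph_def
  proof (intro conjI ballI)
    fix e assume "e \<in> edges H"
    then obtain d where "d \<in> edges G" "e = f ` d" by (auto simp: H_def)
    then show "e \<subseteq> verts H" "card e = 2"
      using sub[of d] f by (auto simp: H_def card_image inj_on_subset)
  qed (simp add: H_def)
  define g where "g = inv_into (verts G) f"
  have gf: "g ` f ` d = d" if "d \<subseteq> verts G" for d
    using that f(1) by (simp add: g_def inv_into_image_cancel)
  have adjH: "x \<in> f ` verts G \<and> adj G (g x) (g y)" if "adj H x y" for x y
  proof -
    from that obtain d where d: "d \<in> edges G" "{x, y} = f ` d" by (auto simp: H_def)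
    have "g ` {x, y} = d" using gf sub(1)[OF d(1)] d(2) by simp
    then have "{g x, g y} \<in> edges G" using d(1) by simp
    moreover have "x \<in> f ` d" unfolding d(2)[symmetric] by simp
    ultimately show ?thesis using sub(1)[OF d(1)] by auto
  qed
  have "\<nexists>p. is_cycle (adj H) p \<and> length p = k"
  proof
    assume "\<exists>p. is_cycle (adj H) p \<and> length p = k"
    then obtain p where p: "is_cycle (adj H) p" "length p = k" by blast
    \<comment> \<open>Each vertex of a cycle lies on an edge, so the added isolated vertices do not
      occur in \<open>p\<close> and \<open>g\<close> is injective on it.\<close>
    have "set p \<subseteq> f ` verts G"
    proof
      fix x assume "x \<in> set p"
      then obtain i where "i < length p" "x = p ! i" by (auto simp: in_set_conv_nth)
      then show "x \<in> f ` verts G" using p(1) adjH by (auto simp: is_cycle_def)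
    qed
    then have "inj_on g (set p)"
      unfolding g_def by (rule inj_on_inv_into)
    then have "is_cycle (adj G) (map g p)"
      using adjH by (intro is_cycle_map[OF p(1)]) auto
    then show False using free p(2) by auto
  qed
  then have "H \<in> free_graphs n {cycle_graph k}"
    using H free_of_cycle_iff[OF H k] by (simp add: free_graphs_def H_def)
  then have "card (triangles H) \<le> ex_copies n (cycle_graph 3) {cycle_graph k}"
    using ex_copies_ge card_copies_triangle[OF H] by metis
  moreover have "card (triangles G) \<le> card (triangles H)"
  proof (rule card_inj_on_le[of "(`) f"])
    show "inj_on ((`) f) (triangles G)"
    proof (rule inj_onI)
      fix S T assume "S \<in> triangles G" "T \<in> triangles G" "f ` S = f ` T"
      then show "S = T" using gf by (metis (mono_tags, lifting) mem_Collect_eq triangles_def)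
    qed
    show "(`) f ` triangles G \<subseteq> triangles H"
    proof
      fix S assume "S \<in> (`) f ` triangles G"
      then obtain T where T: "T \<in> triangles G" "S = f ` T" by blast
      have TG: "T \<subseteq> verts G" "card T = 3" using T by (auto simp: triangles_def)
      have "adj H x y" if xy: "x \<in> S" "y \<in> S" "x \<noteq> y" for x y
      proof -
        obtain a b where ab: "a \<in> T" "b \<in> T" "x = f a" "y = f b" using xy T(2) by blast
        with xy T have "adj G a b" by (auto simp: triangles_def)
        then have "f ` {a, b} \<in> edges H" by (simp only: H_def snd_conv imageI)
        then show ?thesis using ab by simp
      qed
      moreover have "card S = 3" using TG T(2) f by (simp add: card_image inj_on_subset)
      moreover have "S \<subseteq> verts H" using TG(1) f(2) T(2) by (auto simp: H_def)
      ultimately show "S \<in> triangles H" by (simp add: triangles_def)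
    qed
    show "finite (triangles H)" using H by (rule finite_triangles)
  qed
  ultimately show ?thesis by linarith
qed

section \<open>Triangles per edge in graphs without a cycle of given length\<close>

text \<open>Induction on \<open>j\<close>: the ends of the closing edge of a cycle of length
  \<open>j < k\<close> have at least \<open>k\<close> common neighbours, so one of them is off the
  cycle and can be inserted there. The edge \<open>R a b\<close> provides the initial
  triangle.\<close>

lemma cycle_of_large_codegree:
  assumes sym: "\<And>x y. R x y \<Longrightarrow> R y x" and irrefl: "\<And>x. \<not> R x x" and "R a b"
    and codeg: "\<And>x y. R x y \<Longrightarrow> k \<le> card {z. R x z \<and> R z y}"
    and "3 \<le> j" "j \<le> k"
  shows "\<exists>p. is_cycle R p \<and> length p = j"
  using \<open>3 \<le> j\<close> \<open>j \<le> k\<close>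
proof (induction j rule: dec_induct)
  case base
  have "card {z. R a z \<and> R z b} > 0" using codeg[OF \<open>R a b\<close>] \<open>3 \<le> k\<close> by linarith
  then obtain c where "R a c" "R c b" by (metis (no_types, lifting) Collect_empty_eq card.empty less_irrefl)
  then have "is_cycle R [a, c, b]"
    using sym irrefl \<open>R a b\<close> by (auto simp: is_cycle_iff_successively)
  then show ?case by (metis length_Cons list.size(3) numeral_3_eq_3)
next
  case (step j)
  then obtain p where p: "is_cycle R p" "length p = j" by auto
  let ?Z = "{z. R (last p) z \<and> R z (hd p)}"
  have "R (last p) (hd p)" using p(1) by (simp add: is_cycle_iff_successively)
  then have "k \<le> card ?Z" by (rule codeg)
  then have "\<not> ?Z \<subseteq> set p"
    using card_mono[of "set p" ?Z] card_length[of p] p(2) step.prems by auto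
  then obtain z where "z \<notin> set p" "R (last p) z" "R z (hd p)" by blast
  then have "is_cycle R (p @ [z])" using p(1) by (intro is_cycle_snoc)
  then show ?case using p(2) by (intro exI[of _ "p @ [z]"]) simp
qed

text \<open>Induction on the number of edges: by \<open>cycle_of_large_codegree\<close> some edge
  lies in fewer than \<open>k\<close> triangles. Deleting it creates no cycle and destroys only
  these triangles.\<close>

lemma card_triangles_le:
  assumes "simple_graph G" "k \<ge> 3" "\<nexists>p. is_cycle (adj G) p \<and> length p = k"
  shows "card (triangles G) \<le> k * card (edges G)"
  using assms(1,3)
proof (induction "card (edges G)" arbitrary: G)
  case 0
  have "triangles G = {}"
  proof (rule ccontr)
    assume "triangles G \<noteq> {}"
    then obtain T where T: "T \<in> triangles G" by blast
    then have "\<not> card T \<le> Suc 0" by (simp add: triangles_def)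
    then obtain x y where "x \<in> T" "y \<in> T" "x \<noteq> y"
      by (metis T card.infinite card_le_Suc0_iff_eq le0)
    then have "edges G \<noteq> {}" using T by (auto simp: triangles_def)
    then show False using 0 finite_edges(1)[of G] by simp
  qed
  then show ?case by simp
next
  case (Suc m)
  note G = \<open>simple_graph G\<close>
  have fin: "finite (verts G)" using G by (simp add: simple_graph_def)
  have irrefl: "\<not> adj G x x" for x using G by (auto simp: simple_graph_def)
  have "edges G \<noteq> {}" using Suc.hyps(2) by auto
  then obtain d where d: "d \<in> edges G" by blast
  then have "card d = 2" using G by (auto simp: simple_graph_def)
  then obtain a b where "adj G a b" using d by (auto simp: card_2_iff)
  have "\<exists>x y. adj G x y \<and> card {z. adj G x z \<and> adj G z y} < k"
  proof (rule ccontr)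
    assume "\<nexists>x y. adj G x y \<and> card {z. adj G x z \<and> adj G z y} < k"
    then have "k \<le> card {z. adj G x z \<and> adj G z y}" if "adj G x y" for x y
      using that by (meson not_le)
    moreover have "adj G y x" if "adj G x y" for x y
      using that by (simp only: insert_commute)
    ultimately have "\<exists>p. is_cycle (adj G) p \<and> length p = k"
      using irrefl \<open>adj G a b\<close> \<open>k \<ge> 3\<close> by (intro cycle_of_large_codegree[of "adj G" a b k k]) blast+
    then show False using Suc.prems(2) by blast
  qed
  then obtain x y where xy: "adj G x y" "card {z. adj G x z \<and> adj G z y} < k" by blast
  let ?Z = "{z. adj G x z \<and> adj G z y}"
  define G' where "G' = (verts G, edges G - {{x, y}})"
  have card: "card (edges G') = m"
    using xy(1) Suc.hyps(2) finite_edges(1)[OF G] by (simp add: G'_def)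
  have G': "simple_graph G'" using G by (auto simp: simple_graph_def G'_def)
  have "\<nexists>p. is_cycle (adj G') p \<and> length p = k"
  proof
    assume "\<exists>p. is_cycle (adj G') p \<and> length p = k"
    then obtain p where p: "is_cycle (adj G') p" "length p = k" by blast
    from p(1) have "is_cycle (adj G) p" by (rule is_cycle_mono) (simp add: G'_def)
    then show False using p(2) Suc.prems(2) by blast
  qed
  then have IH: "card (triangles G') \<le> k * m"
    using Suc.hyps(1)[of G'] card G' by simp
  have finZ: "finite ?Z"
    by (rule finite_subset[OF _ fin]) (use G in \<open>auto simp: simple_graph_def\<close>)
  have "triangles G \<subseteq> triangles G' \<union> (\<lambda>z. {x, y, z}) ` ?Z"
  proof
    fix T assume T: "T \<in> triangles G"
    show "T \<in> triangles G' \<union> (\<lambda>z. {x, y, z}) ` ?Z"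
    proof (cases "{x, y} \<subseteq> T")
      case True
      have "card T = 3" using T by (simp add: triangles_def)
      then have fT: "finite T" by (metis card.infinite zero_neq_numeral)
      have "x \<noteq> y" using xy(1) irrefl by auto
      then have "card (T - {x, y}) = 1"
        using True fT \<open>card T = 3\<close> by (subst card_Diff_subset) auto
      then obtain z where "T - {x, y} = {z}" by (auto simp: card_1_singleton_iff)
      then have z: "z \<noteq> x" "z \<noteq> y" "T = {x, y, z}" using True by auto
      then have "z \<in> ?Z" using T by (auto simp: triangles_def)
      then show ?thesis using z by blast
    next
      case False
      have "adj G' u v" if "u \<in> T" "v \<in> T" "u \<noteq> v" for u v
      proof -
        have "{u, v} \<noteq> {x, y}" using False that by (metis empty_subsetI insert_subset)
        then show ?thesis using T that by (simp add: G'_def triangles_def)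
      qed
      then have "T \<in> triangles G'" using T by (simp add: triangles_def G'_def)
      then show ?thesis ..
    qed
  qed
  then have "card (triangles G) \<le> card (triangles G' \<union> (\<lambda>z. {x, y, z}) ` ?Z)"
    using finite_triangles[OF G'] finZ by (intro card_mono) auto
  also have "\<dots> \<le> card (triangles G') + card ?Z"
    by (rule order_trans[OF card_Un_le]) (simp add: card_image_le[OF finZ])
  also have "\<dots> \<le> k * m + k" using IH xy(2) by linarith
  finally show ?case unfolding Suc.hyps(2)[symmetric] by simp
qed

lemma ex_copies_le:
  assumes "k \<ge> 3"
  shows "ex_copies n (cycle_graph 3) {cycle_graph k} \<le> k * ex_edges n {cycle_graph k}"
proof -
  have "edges F \<noteq> {}" if "F \<in> {cycle_graph k}" for F
    using that edges_cycle_graph_nonempty[of k] assms by simp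
  then obtain G where G: "G \<in> free_graphs n {cycle_graph k}"
    and eq: "card (copies (cycle_graph 3) G) = ex_copies n (cycle_graph 3) {cycle_graph k}"
    by (rule ex_copies_attained)
  have simple: "simple_graph G" using G by (simp add: free_graphs_def)
  have "card (triangles G) \<le> k * card (edges G)"
    using G free_of_cycle_iff[OF simple assms]
    by (intro card_triangles_le simple assms) (simp add: free_graphs_def)
  then show ?thesis
    using ex_edges_ge[OF G] eq card_copies_triangle[OF simple]
    by (metis le_trans mult_le_mono2)
qed

subsection \<open>Cycles in blow-ups\<close>

text \<open>In a longest path \<open>x # y # q\<close>, a neighbour \<open>z \<noteq> y\<close> of
  \<open>x\<close> cannot prolong the path, so it lies on \<open>q\<close>, and the edge from
  \<open>z\<close> to \<open>x\<close> closes a cycle.\<close>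

lemma exists_cycle_if_min_degree_two:
  assumes fin: "finite V" and V: "\<And>x y. R x y \<Longrightarrow> x \<in> V"
    and sym: "\<And>x y. R x y \<Longrightarrow> R y x" and irrefl: "\<And>x. \<not> R x x"
    and "R a b" and deg: "\<And>x y. R x y \<Longrightarrow> \<exists>z. z \<noteq> y \<and> R x z"
  shows "\<exists>p. is_cycle R p"
proof -
  define path where "path p \<longleftrightarrow> distinct p \<and> successively R p \<and> set p \<subseteq> V \<and> length p \<ge> 2" for p
  have ab: "path [a, b]"
    using \<open>R a b\<close> irrefl V[of a b] V[of b a] sym by (auto simp: path_def)
  have bound: "length p \<le> card V" if "path p" for p
    using card_mono[OF fin, of "set p"] distinct_card[of p] that by (simp add: path_def)
  obtain p where p: "path p" and max: "\<And>q. path q \<Longrightarrow> length q \<le> length p"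
    using ex_has_greatest_nat[of path "[a, b]" length "Suc (card V)", OF ab] bound by (auto simp: less_Suc_eq_le)
  obtain x y q where q: "p = x # y # q"
    using p by (auto simp: path_def numeral_2_eq_2 Suc_le_length_iff)
  then have "R x y" using p by (simp add: path_def)
  then obtain z where z: "z \<noteq> y" "R x z" using deg by blast
  have "z \<in> set p"
  proof (rule ccontr)
    assume "z \<notin> set p"
    then have "path (z # p)"
      using p z q sym V by (auto simp: path_def)
    then show False using max by fastforce
  qed
  moreover have "z \<noteq> x" using z irrefl by auto
  ultimately obtain q1 q2 where "q = q1 @ z # q2"
    using z(1) q by (auto simp: in_set_conv_decomp)
  then have "is_cycle R ((x # y # q1) @ [z])"
    using p q sym[OF z(2)]
    by (auto simp: path_def is_cycle_iff_successively successively_append_iff successively_Cons hd_append)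
  then show ?thesis by blast
qed

text \<open>Moving to the next position on the cycle is injective and leads from positions in
  \<open>P\<close> to positions outside \<open>P\<close>.\<close>

lemma cycle_independent_card:
  assumes p: "is_cycle R p" and indep: "\<And>x y. R x y \<Longrightarrow> \<not> (P x \<and> P y)"
  shows "2 * card {x \<in> set p. P x} \<le> length p"
proof -
  define k where "k = length p"
  have k: "k \<ge> 3" and dist: "distinct p" using p by (auto simp: is_cycle_def k_def)
  let ?I = "{i. i < k \<and> P (p ! i)}" and ?J = "{i. i < k \<and> \<not> P (p ! i)}"
  have lt: "(i + 1) mod k < k" for i using k by simp
  have "card ?I \<le> card ?J"
  proof (rule card_inj_on_le[of "\<lambda>i. (i + 1) mod k"])
    have "(i + 1) mod k = (if i + 1 = k then 0 else i + 1)" if "i < k" for i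
      using that by auto
    then show "inj_on (\<lambda>i. (i + 1) mod k) ?I"
      by (intro inj_onI) (auto split: if_splits)
    show "(\<lambda>i. (i + 1) mod k) ` ?I \<subseteq> ?J"
    proof
      fix j assume "j \<in> (\<lambda>i. (i + 1) mod k) ` ?I"
      then obtain i where i: "i < k" "P (p ! i)" "j = (i + 1) mod k" by blast
      then have "R (p ! i) (p ! j)" using p by (simp add: is_cycle_def k_def)
      then show "j \<in> ?J" using i indep lt by blast
    qed
  qed simp
  moreover have "card ?I + card ?J = k"
  proof -
    have "?I \<union> ?J = {..<k}" by auto
    then show ?thesis by (subst card_Un_disjoint[symmetric]) auto
  qed
  moreover have "card {x \<in> set p. P x} = card ?I"
  proof -
    have "{x \<in> set p. P x} = (!) p ` ?I" by (auto simp: in_set_conv_nth k_def)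
    moreover have "inj_on ((!) p) ?I" using dist by (auto simp: inj_on_def nth_eq_iff_index_eq k_def)
    ultimately show ?thesis by (simp add: card_image)
  qed
  ultimately show ?thesis by (simp add: k_def)
qed

text \<open>\<open>N\<close> is adjacency along the cycle itself, without chords: each vertex has
  exactly two neighbours, and length at least 5 excludes triangles and 4-cycles. This lets the case
  analysis in \<open>blow_up_cycle\<close> speak of neighbours instead of positions.\<close>

lemma cycle_neighbours:
  assumes p: "is_cycle R p" and sym: "\<And>x y. R x y \<Longrightarrow> R y x" and len: "length p \<ge> 5"
  obtains N where "\<And>u v. N u v \<Longrightarrow> N v u" "\<And>u v. N u v \<Longrightarrow> R u v \<and> u \<in> set p"
    "\<exists>u v. N u v"
    "\<And>u v. N u v \<Longrightarrow> \<exists>w. w \<noteq> v \<and> N u w \<and> (\<forall>z. N u z \<longrightarrow> z = v \<or> z = w)"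
    "\<And>u v w. N u v \<Longrightarrow> N v w \<Longrightarrow> \<not> N w u"
    "\<And>u v w z. N u v \<Longrightarrow> N v w \<Longrightarrow> N w z \<Longrightarrow> N z u \<Longrightarrow> u = w \<or> v = z"
proof -
  define k where "k = int (length p)"
  have k: "k \<ge> 5" using len by (simp add: k_def)
  \<comment> \<open>Integer indices modulo \<open>k\<close> allow steps in both directions without
    special cases at the ends of the list.\<close>
  define g where "g i = p ! nat (i mod k)" for i
  have lt: "nat (i mod k) < length p" for i
    using pos_mod_bound[of k i] pos_mod_sign[of k i] k unfolding k_def by linarith
  have g_eq: "g i = g j \<longleftrightarrow> k dvd i - j" for i j
  proof -
    have "g i = g j \<longleftrightarrow> nat (i mod k) = nat (j mod k)"
      using p lt by (simp add: g_def is_cycle_def nth_eq_iff_index_eq)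
    also have "\<dots> \<longleftrightarrow> i mod k = j mod k" using k by (simp add: eq_nat_nat_iff)
    also have "\<dots> \<longleftrightarrow> k dvd i - j" by (rule mod_eq_dvd_iff)
    finally show ?thesis .
  qed
  have g_set: "g i \<in> set p" for i
    using lt by (simp add: g_def)
  have g_R: "R (g i) (g (i + 1))" for i
  proof -
    let ?j = "nat (i mod k)"
    have j: "?j < length p" by (rule lt)
    have "0 \<le> i mod k" using k by simp
    then have "int ((?j + 1) mod length p) = (i mod k + 1) mod k"
      using k by (simp add: zmod_int k_def add.commute)
    also have "\<dots> = (i + 1) mod k" by (simp add: mod_add_left_eq)
    finally have "(?j + 1) mod length p = nat ((i + 1) mod k)" by linarith
    then show ?thesis using p j by (auto simp: is_cycle_def g_def)
  qed
  define N where "N u v \<longleftrightarrow> (\<exists>i s. (s = 1 \<or> s = -1) \<and> u = g i \<and> v = g (i + s))" for u v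
  have N_g: "\<exists>s. (s = 1 \<or> s = -1) \<and> v = g (i + s)" if "N (g i) v" for i v
  proof -
    from that obtain j s where s: "s = 1 \<or> s = -1" "g i = g j" "v = g (j + s)"
      by (auto simp: N_def)
    then have "g (i + s) = g (j + s)" by (simp add: g_eq)
    then show ?thesis using s by auto
  qed
  \<comment> \<open>A closed walk of at most four steps \<open>1\<close> or \<open>-1\<close> has a
    total divisible by \<open>k \<ge> 5\<close>, hence zero. Three such steps have an odd total,
    which is impossible; among four, two consecutive ones cancel.\<close>
  have small: "d = 0" if "k dvd d" "\<bar>d\<bar> < 5" for d
    using dvd_imp_le_int[of d k] that k by linarith
  show thesis
  proof
    show N_sym: "N v u" if uv: "N u v" for u v
    proof -
      obtain i s where s: "s = 1 \<or> s = -1" and e: "u = g i" "v = g (i + s)"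
        using uv unfolding N_def by metis
      have "u = g ((i + s) + (- s))" "- s = 1 \<or> - s = -1" using e s by auto
      then show ?thesis unfolding N_def using e(2) by blast
    qed
    show "R u v \<and> u \<in> set p" if uv: "N u v" for u v
    proof -
      obtain i s where s: "s = 1 \<or> s = -1" and e: "u = g i" "v = g (i + s)"
        using uv unfolding N_def by metis
      from s show ?thesis
      proof
        assume "s = 1" then show ?thesis using e g_R g_set by simp
      next
        assume "s = -1" then show ?thesis using e g_R[of "i - 1"] g_set sym by simp
      qed
    qed
    show "\<exists>u v. N u v" unfolding N_def by metis
    show "\<exists>w. w \<noteq> v \<and> N u w \<and> (\<forall>z. N u z \<longrightarrow> z = v \<or> z = w)" if uv: "N u v" for u v
    proof -
      obtain i s where s: "s = 1 \<or> s = -1" and e: "u = g i" "v = g (i + s)"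
        using uv unfolding N_def by metis
      have "\<not> k dvd 2 * s" using small[of "2 * s"] s by auto
      then have "g (i - s) \<noteq> v" 
        using g_eq[of "i + s" "i - s"] by (simp add: e)
      moreover have "N u (g (i - s))"
        unfolding N_def e using s by (intro exI[of _ i] exI[of _ "- s"]) auto
      moreover have "z = v \<or> z = g (i - s)" if "N u z" for z
        using N_g[of i z] that s by (auto simp: e)
      ultimately show ?thesis by blast
    qed
    show "\<not> N w u" if "N u v" "N v w" for u v w
    proof
      assume "N w u"
      obtain i s where s: "s = 1 \<or> s = -1" and e: "u = g i" "v = g (i + s)"
        using \<open>N u v\<close> unfolding N_def by metis
      obtain t where t: "t = 1 \<or> t = -1" "w = g (i + s + t)"
        using N_g \<open>N v w\<close> e by blast
      obtain r where r: "r = 1 \<or> r = -1" "u = g (i + s + t + r)"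
        using N_g \<open>N w u\<close> t by blast
      then have "k dvd s + t + r" using g_eq[of "i + s + t + r" i] e by (simp add: algebra_simps)
      moreover have "\<bar>s + t + r\<bar> < 5" using s t(1) r(1) by auto
      ultimately have "s + t + r = 0" by (rule small)
      then show False using s t(1) r(1) by auto
    qed
    show "u = w \<or> v = z" if N: "N u v" "N v w" "N w z" "N z u" for u v w z
    proof -
      obtain i s where s: "s = 1 \<or> s = -1" and e: "u = g i" "v = g (i + s)"
        using \<open>N u v\<close> unfolding N_def by metis
      obtain t where t: "t = 1 \<or> t = -1" "w = g (i + s + t)"
        using N_g \<open>N v w\<close> e by blast
      obtain r where r: "r = 1 \<or> r = -1" "z = g (i + s + t + r)"
        using N_g \<open>N w z\<close> t by blast
      obtain r' where r': "r' = 1 \<or> r' = -1" "u = g (i + s + t + r + r')"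
        using N_g \<open>N z u\<close> r by blast
      then have "k dvd s + t + r + r'"
        using g_eq[of "i + s + t + r + r'" i] e by (simp add: algebra_simps)
      moreover have "\<bar>s + t + r + r'\<bar> < 5" using s t(1) r(1) r'(1) by auto
      ultimately have "s + t + r + r' = 0" by (rule small)
      then have "s + t = 0 \<or> t + r = 0" using s t(1) r(1) r'(1) by auto
      then show ?thesis using e t(2) r(2) by (auto simp: add.assoc)
    qed
  qed
qed

text \<open>\<open>E\<close> is meant to be directed from a side A to \<open>B\<close>. A vertex of
  A survives only as \<open>(a, False)\<close>, while \<open>b\<close> in \<open>B\<close> gets the
  twins \<open>(b, False)\<close> and \<open>(b, True)\<close>, joined by the third
  disjunct.\<close>

definition blow_up :: "'a set \<Rightarrow> ('a \<Rightarrow> 'a \<Rightarrow> bool) \<Rightarrow> ('a \<times> bool) \<Rightarrow> ('a \<times> bool) \<Rightarrow> bool" where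
  "blow_up B E u v \<longleftrightarrow> (E (fst u) (fst v) \<and> \<not> snd u) \<or> (E (fst v) (fst u) \<and> \<not> snd v) \<or>
     (fst u = fst v \<and> fst u \<in> B \<and> snd u \<noteq> snd v)"

text \<open>The projection of \<open>p\<close> to \<open>A\<close> and \<open>B\<close>, without its
  vertices of degree one in \<open>A\<close>, has minimum degree two and so contains a cycle
  \<open>q\<close>. Being bipartite, \<open>q\<close> is even, and its vertices in \<open>A\<close>
  are vertices of \<open>p\<close>; as these make up at most half of \<open>p\<close>,
  \<open>q\<close> is no longer than \<open>p\<close>.\<close>

lemma blow_up_cycle:
  assumes disj: "A \<inter> B = {}" and E: "\<And>a b. E a b \<Longrightarrow> a \<in> A \<and> b \<in> B"
    and p: "is_cycle (blow_up B E) p" and len: "length p \<ge> 5"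
  obtains q where "is_cycle (\<lambda>x y. E x y \<or> E y x) q" "even (length q)" "length q \<le> length p"
proof -
  let ?W = "blow_up B E"
  have "?W v u" if "?W u v" for u v using that by (auto simp: blow_up_def)
  from cycle_neighbours[OF p this len]
  obtain N where N_sym: "\<And>u v. N u v \<Longrightarrow> N v u"
    and N_W: "\<And>u v. N u v \<Longrightarrow> ?W u v \<and> u \<in> set p"
    and N_ex: "\<exists>u v. N u v"
    and N_two: "\<And>u v. N u v \<Longrightarrow> \<exists>w. w \<noteq> v \<and> N u w \<and> (\<forall>z. N u z \<longrightarrow> z = v \<or> z = w)"
    and no3: "\<And>u v w. N u v \<Longrightarrow> N v w \<Longrightarrow> \<not> N w u"
    and no4: "\<And>u v w z. N u v \<Longrightarrow> N v w \<Longrightarrow> N w z \<Longrightarrow> N z u \<Longrightarrow> u = w \<or> v = z"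
    by blast
  have nbr_A: "\<not> i \<and> (\<exists>b c. v = (b, c) \<and> E a b)" if "N (a, i) v" "a \<in> A" for a i v
    using N_W[OF that(1)] that(2) E disj by (cases v) (auto simp: blow_up_def)
  have nbr_B: "v = (b, \<not> c) \<or> (\<exists>a. v = (a, False) \<and> E a b)" if "N (b, c) v" "b \<in> B" for b c v
    using N_W[OF that(1)] that(2) E disj by (cases v) (auto simp: blow_up_def)
  \<comment> \<open>Both cycle neighbours of such an \<open>a\<close> are twins over one
    \<open>b\<close>, so \<open>a\<close> would have degree one in the projection.\<close>
  define pendant where "pendant a \<longleftrightarrow> (\<exists>b. N (a, False) (b, True) \<and> N (a, False) (b, False))" for a
  have pendantD: "N (a, False) (b, \<not> c)" if pend: "pendant a" and N: "N (a, False) (b, c)" for a b c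
  proof -
    obtain b' where b': "N (a, False) (b', True)" "N (a, False) (b', False)"
      using pend by (auto simp: pendant_def)
    obtain w where "\<forall>z. N (a, False) z \<longrightarrow> z = (b', True) \<or> z = w"
      using N_two[OF b'(1)] by blast
    then have "(b, c) = (b', True) \<or> (b, c) = (b', False)" using b' N by (metis prod.inject)
    then show ?thesis using b' by auto
  qed
  \<comment> \<open>\<open>T\<close> is the projection of the cycle after deleting the pendant
    vertices, with edges still directed from \<open>A\<close> to \<open>B\<close>.\<close>
  define T where "T a b \<longleftrightarrow> E a b \<and> \<not> pendant a \<and> (\<exists>c. N (a, False) (b, c))" for a b
  have T_A: "\<exists>b'. b' \<noteq> b \<and> T a b'" if ab: "T a b" for a b
  proof -
    obtain c where c: "N (a, False) (b, c)" using ab by (auto simp: T_def)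
    obtain w where w: "w \<noteq> (b, c)" "N (a, False) w" using N_two[OF c] by blast
    have "a \<in> A" using ab E by (auto simp: T_def)
    with nbr_A[OF w(2)] obtain b' c' where b': "w = (b', c')" "E a b'" by blast
    have "b' \<noteq> b"
    proof
      assume "b' = b"
      then have "N (a, False) (b, True) \<and> N (a, False) (b, False)"
        using w b' c by (cases c; cases c') auto
      then show False using ab by (auto simp: T_def pendant_def)
    qed
    then show ?thesis using b' w ab by (auto simp: T_def)
  qed
  have T_B: "\<exists>a'. a' \<noteq> a \<and> T a' b" if ab: "T a b" for a b
  proof -
    obtain c where c: "N (a, False) (b, c)" using ab by (auto simp: T_def)
    have bB: "b \<in> B" and bA: "b \<notin> A" using ab E disj by (auto simp: T_def)
    obtain y where y: "y \<noteq> (a, False)" "N (b, c) y"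
      and only: "\<And>z. N (b, c) z \<Longrightarrow> z = (a, False) \<or> z = y"
      using N_two[OF N_sym[OF c]] by blast
    from nbr_B[OF y(2) bB] consider "y = (b, \<not> c)" | a' where "y = (a', False)" "E a' b" by blast
    then show ?thesis
    proof cases
      \<comment> \<open>The cycle runs through \<open>a\<close>, both twins of \<open>b\<close> and
        then \<open>a'\<close>. If \<open>a'\<close> equalled \<open>a\<close> or were pendant, it
        would be adjacent to both twins, and this would be a triangle in \<open>N\<close>.\<close>
      case 1
      obtain w where w: "w \<noteq> (b, c)" "N (b, \<not> c) w"
        using N_two[OF N_sym[OF y(2)[unfolded 1]]] by blast
      then obtain a' where a': "w = (a', False)" "E a' b" using nbr_B[OF w(2) bB] by auto
      have "\<not> N (b, c) (a', False)" using no3[of "(b, c)" "(b, \<not> c)" "(a', False)"] y(2) 1 w a' N_sym by blast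
      then have "a' \<noteq> a" "\<not> pendant a'"
        using c N_sym pendantD[of a' b "\<not> c"] w(2) a'(1) by auto
      moreover have "N (a', False) (b, \<not> c)" using a'(1) w(2) N_sym by blast
      ultimately show ?thesis using a'(2) unfolding T_def by blast
    next
      case (2 a')
      show ?thesis
      proof (cases "pendant a'")
        case False
        moreover have "N (a', False) (b, c)" using y(2) 2(1) N_sym by blast
        ultimately show ?thesis using 2 y(1) unfolding T_def by blast
      next
        \<comment> \<open>A pendant \<open>a'\<close> leads on to the other twin of
          \<open>b\<close>, and the vertex \<open>a''\<close> after that one is the witness:
          \<open>a'' = a\<close> would close a 4-cycle, and a pendant \<open>a''\<close> would be a
          third neighbour of \<open>(b, c)\<close>.\<close>
        case True
        then have a'c: "N (a', False) (b, \<not> c)" using pendantD 2 y N_sym by blast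
        then obtain z where z: "z \<noteq> (a', False)" "N (b, \<not> c) z"
          using N_two[OF N_sym[OF a'c]] by blast
        have "\<not> N (b, c) (b, \<not> c)" using only[of "(b, \<not> c)"] 2 bA ab E by (auto simp: T_def)
        then have "z \<noteq> (b, c)" using z(2) N_sym by blast
        then obtain a'' where a'': "z = (a'', False)" "E a'' b" using nbr_B[OF z(2) bB] by auto
        have "a'' \<noteq> a"
          using no4[OF c y(2)[unfolded 2] a'c] z(2) a''(1) y(1) 2(1) by auto
        moreover have "\<not> pendant a''"
        proof
          assume "pendant a''"
          then have "N (a'', False) (b, c)" using pendantD[of a'' b "\<not> c"] z(2) a''(1) N_sym by auto
          then have "(a'', False) = (a, False) \<or> (a'', False) = y" using only N_sym by blast
          then show False using \<open>a'' \<noteq> a\<close> z(1) a''(1) 2(1) by auto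
        qed
        moreover have "N (a'', False) (b, \<not> c)" using z(2) a''(1) N_sym by blast
        ultimately show ?thesis using a''(2) unfolding T_def by blast
      qed
    qed
  qed
  have T_ex: "\<exists>a b. T a b"
  proof -
    obtain u v where uv: "N u v" using N_ex by blast
    have "\<exists>b c w. b \<in> B \<and> N (b, c) w"
    proof (cases "fst u \<in> A")
      case True
      then obtain b c where "v = (b, c)" "E (fst u) b" using nbr_A[of "fst u" "snd u" v] uv by auto
      then show ?thesis using E N_sym[OF uv] by blast
    next
      case False
      then have "fst u \<in> B" using N_W[OF uv] E by (auto simp: blow_up_def)
      then show ?thesis using uv by (metis prod.collapse)
    qed
    then obtain b c w where b: "b \<in> B" and w: "N (b, c) w" by blast
    obtain y where y: "y \<noteq> w" "N (b, c) y" using N_two[OF w] by blast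
    \<comment> \<open>Next to a twin pair, a pendant \<open>a\<close> would complete a triangle in
      \<open>N\<close>.\<close>
    have *: "\<exists>a b. T a b" if N: "N (b, c) (b, \<not> c)" "N (b, c) (a, False)" "E a b" for a
    proof -
      have "\<not> pendant a"
        using pendantD[of a b c] N_sym N no3[of "(b, c)" "(b, \<not> c)" "(a, False)"] by blast
      then show ?thesis using N N_sym unfolding T_def by blast
    qed
    \<comment> \<open>If \<open>a\<close> and \<open>a'\<close> were both pendant, they would form a
      4-cycle in \<open>N\<close> with the two twins of \<open>b\<close>.\<close>
    have **: "\<exists>a b. T a b" if N: "N (b, c) (a, False)" "E a b" "N (b, c) (a', False)" "E a' b" "a \<noteq> a'" for a a'
    proof (rule ccontr)
      assume none: "\<not> ?thesis"
      have "N (a, False) (b, c)" "N (a', False) (b, c)" using N N_sym by blast+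
      then have "pendant a" "pendant a'" using none N(2,4) unfolding T_def by blast+
      then have "N (a, False) (b, \<not> c)" "N (a', False) (b, \<not> c)"
        using pendantD N N_sym by blast+
      then show False using no4[of "(b, c)" "(a, False)" "(b, \<not> c)" "(a', False)"] N N_sym by auto
    qed
    show ?thesis using nbr_B[OF w b] nbr_B[OF y(2) b] w y * ** by metis
  qed
  define R where "R x y \<longleftrightarrow> T x y \<or> T y x" for x y
  have R_E: "E x y \<or> E y x" if "R x y" for x y using that by (auto simp: R_def T_def)
  have R_p: "x \<in> fst ` set p" if "R x y" for x y
    using that N_W N_sym unfolding R_def T_def by (metis fst_conv imageI)
  obtain a b where "T a b" using T_ex by blast
  have "\<exists>q. is_cycle R q"
  proof (rule exists_cycle_if_min_degree_two)
    show "finite (fst ` set p)" by simp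
    show "R a b" using \<open>T a b\<close> by (simp add: R_def)
    show "\<exists>z. z \<noteq> y \<and> R x z" if "R x y" for x y
      using that T_A T_B unfolding R_def by blast
    show "\<not> R x x" for x using R_E[of x x] E disj by blast
  qed (use R_p in \<open>auto simp: R_def\<close>)
  then obtain q where q: "is_cycle R q" by blast
  have R_set: "\<exists>y. R x y" if "x \<in> set q" for x
    using q that by (auto simp: is_cycle_def in_set_conv_nth)
  let ?qA = "{x \<in> set q. x \<in> A}" and ?qB = "{x \<in> set q. x \<in> B}"
  \<comment> \<open>Both sides are independent in \<open>q\<close> and together cover it, so each
    contains exactly half of its vertices.\<close>
  have cA: "2 * card ?qA \<le> length q"
    by (rule cycle_independent_card[OF q]) (use R_E E disj in blast)
  have cB: "2 * card ?qB \<le> length q"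
    by (rule cycle_independent_card[OF q]) (use R_E E disj in blast)
  have "set q = ?qA \<union> ?qB" using R_set R_E E by blast
  moreover have "card (?qA \<union> ?qB) = card ?qA + card ?qB"
    using disj by (intro card_Un_disjoint) auto
  ultimately have "length q = card ?qA + card ?qB"
    using q by (metis distinct_card is_cycle_def)
  then have lenq: "length q = 2 * card ?qA" using cA cB by linarith
  \<comment> \<open>Each vertex of \<open>q\<close> in \<open>A\<close> comes from its only copy,
    labelled \<open>False\<close>, on \<open>p\<close>.\<close>
  have "card ?qA \<le> card {u \<in> set p. fst u \<in> A}"
  proof (rule card_inj_on_le[of "\<lambda>a. (a, False)"])
    show "(\<lambda>a. (a, False)) ` ?qA \<subseteq> {u \<in> set p. fst u \<in> A}"
    proof clarsimp
      fix a assume a: "a \<in> set q" "a \<in> A"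
      then obtain b where "R a b" using R_set by blast
      then have "\<exists>c. N (a, False) (b, c)" using a E disj by (auto simp: R_def T_def)
      then show "(a, False) \<in> set p" using N_W by blast
    qed
  qed (auto simp: inj_on_def)
  moreover have "2 * card {u \<in> set p. fst u \<in> A} \<le> length p"
    by (rule cycle_independent_card[OF p]) (use E disj in \<open>auto simp: blow_up_def\<close>)
  ultimately have "length q \<le> length p" using lenq by linarith
  moreover have "is_cycle (\<lambda>x y. E x y \<or> E y x) q"
    using q R_E by (rule is_cycle_mono)
  ultimately show thesis using that lenq by simp
qed

section \<open>Unbalanced bipartite subgraphs and their blow-ups\<close>

definition arcs_between :: "('a \<Rightarrow> 'a \<Rightarrow> bool) \<Rightarrow> 'a set \<Rightarrow> 'a set \<Rightarrow> ('a \<times> 'a) set" where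
  "arcs_between R S Y = (SIGMA x:S. {y \<in> Y. R x y})"

lemma finite_arcs_between: "finite S \<Longrightarrow> finite Y \<Longrightarrow> finite (arcs_between R S Y)"
  by (simp add: arcs_between_def)

lemma card_arcs_between_commute:
  assumes sym: "\<And>x y. R x y \<Longrightarrow> R y x"
  shows "card (arcs_between R S Y) = card (arcs_between R Y S)"
  by (rule bij_betw_same_card[of prod.swap], rule bij_betw_byWitness[of _ prod.swap])
    (auto simp: arcs_between_def intro: sym)

text \<open>Greedy cut: vertices are added one at a time, each to the side opposite to the majority
  of its earlier neighbours, so at least half of the new edges cross.\<close>

lemma large_cut:
  assumes "finite V" and sym: "\<And>x y. R x y \<Longrightarrow> R y x" and irrefl: "\<And>x. \<not> R x x"
  shows "\<exists>S\<subseteq>V. card {{x, y} | x y. x \<in> V \<and> y \<in> V \<and> R x y} \<le> 2 * card (arcs_between R S (V - S))"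
  using \<open>finite V\<close>
proof (induction V)
  case (insert v V)
  let ?E = "\<lambda>V. {{x, y} | x y. x \<in> V \<and> y \<in> V \<and> R x y}"
  obtain S where S: "S \<subseteq> V" "card (?E V) \<le> 2 * card (arcs_between R S (V - S))"
    using insert.IH by blast
  let ?D1 = "{w \<in> S. R v w}" and ?D2 = "{w \<in> V - S. R v w}"
  have fin: "finite S" "finite ?D1" "finite ?D2"
    using insert.hyps(1) S(1) by (auto intro: finite_subset)
  have finE: "finite (?E V)"
    by (rule finite_subset[of _ "Pow V"]) (use insert.hyps in auto)
  have "?E (insert v V) \<subseteq> ?E V \<union> (\<lambda>w. {v, w}) ` (?D1 \<union> ?D2)"
  proof
    fix e assume "e \<in> ?E (insert v V)"
    then obtain x y where e: "e = {x, y}" "x \<in> insert v V" "y \<in> insert v V" "R x y" by blast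
    with irrefl consider "x = v" "y \<in> V" | "y = v" "x \<in> V" | "x \<in> V" "y \<in> V" by blast
    then show "e \<in> ?E V \<union> (\<lambda>w. {v, w}) ` (?D1 \<union> ?D2)"
    proof cases
      case 1
      then show ?thesis using e by blast
    next
      case 2
      then have "e = {v, x}" "R v x" using e sym by auto
      then show ?thesis using 2 by blast
    next
      case 3
      then show ?thesis using e by blast
    qed
  qed
  then have "card (?E (insert v V)) \<le> card (?E V \<union> (\<lambda>w. {v, w}) ` (?D1 \<union> ?D2))"
    using finE fin by (intro card_mono) simp_all
  also have "\<dots> \<le> card (?E V) + card ((\<lambda>w. {v, w}) ` (?D1 \<union> ?D2))"
    by (rule card_Un_le)
  also have "card ((\<lambda>w. {v, w}) ` (?D1 \<union> ?D2)) \<le> card (?D1 \<union> ?D2)"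
    using fin by (intro card_image_le) simp
  also have "card (?D1 \<union> ?D2) \<le> card ?D1 + card ?D2" by (rule card_Un_le)
  finally have le: "card (?E (insert v V)) \<le> card (?E V) + (card ?D1 + card ?D2)" by simp
  show ?case
  proof (cases "card ?D2 \<le> card ?D1")
    case True
    have "arcs_between R S (insert v V - S) = arcs_between R S (V - S) \<union> (\<lambda>w. (w, v)) ` ?D1"
      using S(1) sym insert.hyps(2) by (auto simp: arcs_between_def)
    also have "card \<dots> = card (arcs_between R S (V - S)) + card ((\<lambda>w. (w, v)) ` ?D1)"
      using fin insert.hyps
      by (intro card_Un_disjoint finite_arcs_between finite_imageI) (auto simp: arcs_between_def)
    also have "card ((\<lambda>w. (w, v)) ` ?D1) = card ?D1" by (intro card_image) (auto simp: inj_on_def)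
    finally show ?thesis using le S True by (intro exI[of _ S]) auto
  next
    case False
    have "arcs_between R (insert v S) (insert v V - insert v S) =
        arcs_between R S (V - S) \<union> (\<lambda>w. (v, w)) ` ?D2"
      using S(1) sym insert.hyps(2) by (auto simp: arcs_between_def)
    also have "card \<dots> = card (arcs_between R S (V - S)) + card ((\<lambda>w. (v, w)) ` ?D2)"
      using fin S(1) insert.hyps
      by (intro card_Un_disjoint finite_arcs_between finite_imageI) (auto simp: arcs_between_def)
    also have "card ((\<lambda>w. (v, w)) ` ?D2) = card ?D2" by (intro card_image) (auto simp: inj_on_def)
    finally show ?thesis using le S False by (intro exI[of _ "insert v S"]) auto
  qed
qed (simp add: arcs_between_def)

text \<open>Of two complementary halves one carries at least half of the weight; the
  \<open>+ 1\<close> allows for this being the larger half of an odd set.\<close>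

lemma half_of_weight:
  fixes w :: "'a \<Rightarrow> nat"
  assumes "finite S"
  obtains S' where "S' \<subseteq> S" "2 * card S' \<le> card S + 1" "sum w S \<le> 2 * sum w S'"
proof -
  obtain Y where Y: "Y \<subseteq> S" "card Y = card S div 2"
    using obtain_subset_with_card_n[of "card S div 2" S] by auto
  have "card (S - Y) = card S - card S div 2"
    using Y assms by (simp add: card_Diff_subset finite_subset)
  then have "2 * card (S - Y) \<le> card S + 1" by linarith
  moreover have "sum w S = sum w Y + sum w (S - Y)"
    using sum.subset_diff[OF Y(1) assms, of w] by simp
  ultimately show thesis
    using that[OF Y(1)] that[of "S - Y"] Y(2) by (cases "sum w S \<le> 2 * sum w Y") auto
qed

text \<open>The size bound leaves room for doubling the vertices of \<open>B\<close>. The factor 8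
  is a factor 2 for the cut and a factor 2 for halving each of its sides.\<close>

lemma unbalanced_bipartite_subgraph:
  assumes G: "simple_graph G" and n: "card (verts G) \<ge> 5"
  obtains A B where "A \<subseteq> verts G" "B \<subseteq> verts G" "A \<inter> B = {}" "card A + 2 * card B \<le> card (verts G)"
    "card (edges G) \<le> 8 * card (arcs_between (adj G) A B)"
proof -
  let ?V = "verts G"
  have fin: "finite ?V" using G by (simp add: simple_graph_def)
  have sym: "adj G y x" if "adj G x y" for x y using that by (simp only: insert_commute)
  have irrefl: "\<not> adj G x x" for x using G by (auto simp: simple_graph_def)
  have comm: "card (arcs_between (adj G) Y Z) = card (arcs_between (adj G) Z Y)" for Y Z
    using sym by (rule card_arcs_between_commute)
  obtain S where S: "S \<subseteq> ?V"
    "card {{x, y} | x y. x \<in> ?V \<and> y \<in> ?V \<and> adj G x y} \<le> 2 * card (arcs_between (adj G) S (?V - S))"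
    using large_cut[of ?V "adj G", OF fin sym irrefl] by blast
  have "edges G \<subseteq> {{x, y} | x y. x \<in> ?V \<and> y \<in> ?V \<and> adj G x y}"
  proof
    fix e assume e: "e \<in> edges G"
    then have "card e = 2" "e \<subseteq> ?V" using G by (auto simp: simple_graph_def)
    then show "e \<in> {{x, y} | x y. x \<in> ?V \<and> y \<in> ?V \<and> adj G x y}"
      using e by (auto simp: card_2_iff)
  qed
  moreover have "finite {{x, y} | x y. x \<in> ?V \<and> y \<in> ?V \<and> adj G x y}"
    by (rule finite_subset[of _ "Pow ?V"]) (use fin in auto)
  ultimately have "card (edges G) \<le> card {{x, y} | x y. x \<in> ?V \<and> y \<in> ?V \<and> adj G x y}"
    by (rule card_mono[rotated])
  then have X_edges: "card (edges G) \<le> 2 * card (arcs_between (adj G) S (?V - S))" using S by linarith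
  obtain P Q where PQ: "P \<subseteq> ?V" "Q \<subseteq> ?V" "P \<inter> Q = {}" "card P + card Q = card ?V" "card Q \<le> card P"
    "card (edges G) \<le> 2 * card (arcs_between (adj G) P Q)"
  proof -
    have "card S + card (?V - S) = card ?V"
      using S(1) fin by (metis card_Diff_subset card_mono finite_subset le_add_diff_inverse)
    then show thesis
      using that[of S "?V - S"] that[of "?V - S" S] S(1) X_edges
        comm[of S "?V - S"] by fastforce
  qed
  have finPQ: "finite P" "finite Q" using PQ fin finite_subset by blast+
  have arcs: "card (arcs_between (adj G) Y Z) = (\<Sum>y\<in>Y. card {z \<in> Z. adj G y z})" if "finite Y" "finite Z" for Y Z
    unfolding arcs_between_def using that by (subst card_SigmaI) auto
  have half: "\<exists>Y'\<subseteq>Y. 2 * card Y' \<le> card Y + 1 \<and>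
      card (arcs_between (adj G) Y Z) \<le> 2 * card (arcs_between (adj G) Y' Z)"
    if fYZ: "finite Y" "finite Z" for Y Z
  proof -
    obtain Y' where Y': "Y' \<subseteq> Y" "2 * card Y' \<le> card Y + 1"
      "(\<Sum>y\<in>Y. card {z \<in> Z. adj G y z}) \<le> 2 * (\<Sum>y\<in>Y'. card {z \<in> Z. adj G y z})"
      using half_of_weight[OF fYZ(1)] by blast
    then show ?thesis using arcs fYZ finite_subset[OF Y'(1) fYZ(1)] by (intro exI[of _ Y']) simp
  qed
  obtain A where A: "A \<subseteq> P" "2 * card A \<le> card P + 1"
    "card (arcs_between (adj G) P Q) \<le> 2 * card (arcs_between (adj G) A Q)"
    using half[OF finPQ] by blast
  have finA: "finite A" using A(1) finPQ(1) by (rule finite_subset)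
  \<comment> \<open>The heavier half of \<open>Q\<close> is chosen with respect to arcs into
    \<open>A\<close> rather than \<open>P\<close>, so that the two losses multiply.\<close>
  obtain B where B: "B \<subseteq> Q" "2 * card B \<le> card Q + 1"
    "card (arcs_between (adj G) Q A) \<le> 2 * card (arcs_between (adj G) B A)"
    using half[OF finPQ(2) finA] by blast
  show thesis
  proof (rule that[of A B])
    \<comment> \<open>The left side is at most \<open>(card P + 1) / 2 + card Q + 1\<close>. As the
      larger part of at least five vertices, \<open>P\<close> has at least three, which absorbs the
      rounding.\<close>
    show "card A + 2 * card B \<le> card ?V"
      using A(2) B(2) PQ(4,5) n by linarith
    show "card (edges G) \<le> 8 * card (arcs_between (adj G) A B)"
      using A(3) B(3) PQ(6) comm[of Q A] comm[of B A] by linarith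
  qed (use A B PQ in auto)
qed

text \<open>Each edge between \<open>A\<close> and \<open>B\<close> becomes a triangle with the
  twins of its end in \<open>B\<close>. The case of 4-cycles needs another construction, because
  twins and two of their common neighbours form one.\<close>

lemma many_triangles_from_high_girth:
  assumes G: "simple_graph G" "card (verts G) \<ge> 5" and k: "k \<ge> 5"
    and free: "\<nexists>q. is_cycle (adj G) q \<and> even (length q) \<and> length q \<le> k"
  shows "card (edges G) \<le> 8 * ex_copies (card (verts G)) (cycle_graph 3) {cycle_graph k}"
proof -
  obtain A B where AB: "A \<subseteq> verts G" "B \<subseteq> verts G" "A \<inter> B = {}"
    "card A + 2 * card B \<le> card (verts G)"
    "card (edges G) \<le> 8 * card (arcs_between (adj G) A B)"
    using unbalanced_bipartite_subgraph[OF G] .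
  have fin: "finite A" "finite B" using AB G by (auto simp: simple_graph_def intro: finite_subset)
  define E where "E a b \<longleftrightarrow> a \<in> A \<and> b \<in> B \<and> adj G a b" for a b
  let ?W = "blow_up B E"
  define H where "H = (A \<times> {False} \<union> B \<times> UNIV, {{u, v} | u v. ?W u v})"
  have W_sym: "?W v u" if "?W u v" for u v using that by (auto simp: blow_up_def)
  have adjH: "adj H u v \<longleftrightarrow> ?W u v" for u v
    using W_sym[of u v] W_sym[of v u] unfolding H_def snd_conv mem_Collect_eq doubleton_eq_iff by blast
  have irrefl: "\<not> ?W u u" for u using AB(3) by (auto simp: blow_up_def E_def)
  have W_verts: "u \<in> verts H" if "?W u v" for u v
    using that by (cases u) (auto simp: blow_up_def E_def H_def)
  have H: "simple_graph H"
    unfolding simple_graph_def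
  proof (intro conjI ballI)
    show "finite (verts H)" using fin by (simp add: H_def)
    fix e assume "e \<in> edges H"
    then obtain u v where e: "e = {u, v}" "?W u v" by (auto simp: H_def)
    then show "e \<subseteq> verts H" using W_verts W_sym by blast
    have "u \<noteq> v" using e irrefl by blast
    then show "card e = 2" using e by simp
  qed
  have "card (verts H) = card A + 2 * card B"
    using fin AB(3) by (simp add: H_def card_Un_disjoint card_cartesian_product disjoint_iff)
  then have card_H: "card (verts H) \<le> card (verts G)" using AB(4) by simp
  have "\<nexists>p. is_cycle (adj H) p \<and> length p = k"
  proof
    assume "\<exists>p. is_cycle (adj H) p \<and> length p = k"
    then obtain p where p: "is_cycle ?W p" "length p = k" using adjH by (auto simp: is_cycle_def)
    obtain q where q: "is_cycle (\<lambda>x y. E x y \<or> E y x) q" "even (length q)" "length q \<le> length p"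
      using blow_up_cycle[OF AB(3) _ p(1)] p(2) k by (auto simp: E_def)
    have "is_cycle (adj G) q"
      using q(1) by (rule is_cycle_mono) (auto simp: E_def insert_commute)
    then show False using free q p(2) by blast
  qed
  then have "card (triangles H) \<le> ex_copies (card (verts G)) (cycle_graph 3) {cycle_graph k}"
    using triangles_le_ex_copies[OF H card_H] k by simp
  moreover have "card (arcs_between (adj G) A B) \<le> card (triangles H)"
  proof (rule card_inj_on_le[of "\<lambda>(a, b). {(a, False), (b, False), (b, True)}"])
    show "inj_on (\<lambda>(a, b). {(a, False), (b, False), (b, True)}) (arcs_between (adj G) A B)"
    proof (rule inj_onI, clarify)
      fix a b a' b'
      assume mem: "(a, b) \<in> arcs_between (adj G) A B" "(a', b') \<in> arcs_between (adj G) A B"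
        and eq: "{(a, False), (b, False), (b, True)} = {(a', False), (b', False), (b', True)}"
      have "(b, True) \<in> {(a', False), (b', False), (b', True)}" unfolding eq[symmetric] by simp
      then have "b = b'" by simp
      moreover have "(a, False) \<in> {(a', False), (b', False), (b', True)}" unfolding eq[symmetric] by simp
      then have "a = a'" using mem AB(3) by (auto simp: arcs_between_def)
      ultimately show "a = a' \<and> b = b'" by simp
    qed
    show "(\<lambda>(a, b). {(a, False), (b, False), (b, True)}) ` arcs_between (adj G) A B \<subseteq> triangles H"
    proof clarify
      fix a b assume "(a, b) \<in> arcs_between (adj G) A B"
      then have ab: "a \<in> A" "b \<in> B" "adj G a b" "a \<noteq> b"
        using AB(3) by (auto simp: arcs_between_def)
      then show "{(a, False), (b, False), (b, True)} \<in> triangles H"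
        unfolding triangles_def mem_Collect_eq adjH by (auto simp: H_def blow_up_def E_def)
    qed
  qed (rule finite_triangles[OF H])
  ultimately show ?thesis using AB(5) by linarith
qed

subsection \<open>Graphs without 4-cycles\<close>

lemma bit_alg_closure_double: "(x::bit alg_closure) + x = 0"
proof -
  have "(1::bit alg_closure) + 1 = to_ac (1 + 1)"
    by (simp only: to_ac_add to_ac_1)
  also have "(1::bit) + 1 = 0" by simp
  also have "to_ac (0::bit) = 0" by (rule to_ac_0)
  finally have "(1 + 1) * x = 0" by (simp only: mult_zero_left)
  then show ?thesis by (simp only: distrib_right mult_1_left)
qed

text \<open>In characteristic 2 the mixed term \<open>a * b + a * b\<close> of a square vanishes, so
  squaring is additive; this is iterated \<open>k\<close> times.\<close>

lemma bit_alg_closure_frobenius: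
  "((x::bit alg_closure) + y) ^ 2 ^ k = x ^ 2 ^ k + y ^ 2 ^ k"
proof (induction k)
  case (Suc k)
  have "(a + b)\<^sup>2 = a\<^sup>2 + b\<^sup>2 + (a * b + a * b)" for a b :: "bit alg_closure"
    unfolding power2_eq_square distrib_left distrib_right
    by (simp only: ac_simps)
  then have sq: "(a + b)\<^sup>2 = a\<^sup>2 + b\<^sup>2" for a b :: "bit alg_closure"
    by (simp only: bit_alg_closure_double add_0_right)
  show ?case
    unfolding power_Suc2 power_mult Suc.IH by (rule sq)
qed simp

text \<open>The polynomial splits into linear factors. A repeated factor would survive in the
  derivative and give a common root, so the factors are distinct.\<close>

lemma card_roots_eq_degree:
  fixes p :: "'a :: alg_closed_field poly"
  assumes "p \<noteq> 0" and simple: "\<And>a. poly p a = 0 \<Longrightarrow> poly (pderiv p) a \<noteq> 0"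
  shows "card {x. poly p x = 0} = Polynomial.degree p"
proof (rule antisym)
  show "card {x. poly p x = 0} \<le> Polynomial.degree p"
    using assms(1) by (rule card_poly_roots_bound)
  obtain A where A: "size A = Polynomial.degree p"
    "p = smult (Polynomial.lead_coeff p) (\<Prod>x\<in>#A. [:-x, 1:])"
    using alg_closed_imp_factorization[OF assms(1)] by blast
  have root: "poly p a = 0" if "a \<in># A" for a
  proof -
    have "[:-a, 1:] dvd (\<Prod>x\<in>#A. [:-x, 1:])"
      using that by (meson dvd_prod_mset image_eqI image_mset_is_empty_iff in_image_mset)
    then have "[:-a, 1:] dvd p" by (subst A(2)) (rule dvd_smult)
    then show ?thesis by (simp add: poly_eq_0_iff_dvd)
  qed
  have "count A a \<le> 1" for a
  proof (rule ccontr)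
    assume "\<not> count A a \<le> 1"
    then have "a \<in># A" "a \<in># A - {#a#}"
      by (auto simp flip: count_greater_zero_iff)
    then obtain B where B: "A = add_mset a (add_mset a B)"
      by (metis insert_DiffM)
    define r where "r = smult (Polynomial.lead_coeff p) (\<Prod>x\<in>#B. [:-x, 1:])"
    have "p = [:-a, 1:] * ([:-a, 1:] * r)"
      by (subst A(2)) (simp add: B r_def mult_ac)
    then have "poly (pderiv p) a = 0"
      by (simp only: pderiv_mult) (simp add: pderiv_pCons)
    with simple root[OF \<open>a \<in># A\<close>] show False by blast
  qed
  then have "mset_set (set_mset A) = A"
    by (intro multiset_eqI) (metis One_nat_def count_eq_zero_iff count_mset_set(1) count_mset_set(3) finite_set_mset le_Suc_eq le_zero_eq)
  then have "card (set_mset A) = Polynomial.degree p"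
    by (metis A(1) size_mset_set)
  moreover have "finite {x. poly p x = 0}" using assms(1) by (rule poly_roots_finite)
  ultimately show "Polynomial.degree p \<le> card {x. poly p x = 0}"
    using root by (metis (mono_tags, lifting) card_mono mem_Collect_eq subsetI)
qed

text \<open>For \<open>k \<ge> 1\<close> this is the field of order \<open>2 ^ k\<close>, as the
  fixed points of the \<open>k\<close>-th power of the Frobenius map. For \<open>k = 0\<close> it is
  the whole closure.\<close>

definition gf2 :: "nat \<Rightarrow> bit alg_closure set" where
  "gf2 k = {x. x ^ 2 ^ k = x}"

lemma card_gf2:
  assumes "k \<ge> 1"
  shows "card (gf2 k) = 2 ^ k"
proof -
  define p :: "bit alg_closure poly" where "p = monom 1 (2 ^ k) - [:0, 1:]"
  have "(2::nat) ^ k > 1" using assms by (intro one_less_power) auto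
  then have deg: "Polynomial.degree p = 2 ^ k"
    unfolding p_def diff_conv_add_uminus
    by (subst degree_add_eq_left) (simp_all add: degree_monom_eq)
  have "p \<noteq> 0" using deg by auto
  \<comment> \<open>The derivative of the leading term vanishes in characteristic 2, which leaves
    the constant \<open>- 1\<close> and hence only simple roots.\<close>
  moreover have "of_nat (2 ^ k) = (0::bit alg_closure)"
    using assms bit_alg_closure_double[of 1] by (cases k) simp_all
  then have "pderiv p = - 1"
    by (simp add: p_def pderiv_diff pderiv_monom pderiv_pCons one_pCons zero_power)
  ultimately have "card {x. poly p x = 0} = 2 ^ k"
    using card_roots_eq_degree[of p] deg by simp
  then show ?thesis
    by (simp add: p_def gf2_def poly_monom)
qed

lemma gf2_closed:
  assumes "x \<in> gf2 k" "y \<in> gf2 k"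
  shows "x + y \<in> gf2 k" "x * y \<in> gf2 k" "inverse x \<in> gf2 k"
  using assms by (auto simp: gf2_def bit_alg_closure_frobenius power_mult_distrib power_inverse)

section \<open>The polarity graph of an affine plane\<close>

text \<open>In characteristic 2, \<open>(a, b)\<close> satisfies the equation with
  \<open>(c, d)\<close> iff the point \<open>(a, b)\<close> lies on the line
  \<open>y = c * x + d\<close>; the relation is symmetric. The condition \<open>u \<noteq> v\<close>
  removes the loops at points on their own line.\<close>

definition polarity_graph :: "nat \<Rightarrow> (bit alg_closure \<times> bit alg_closure) graph" where
  "polarity_graph k = (gf2 k \<times> gf2 k,
     {{u, v} | u v. u \<in> gf2 k \<times> gf2 k \<and> v \<in> gf2 k \<times> gf2 k \<and> u \<noteq> v \<and> snd u + snd v = fst u * fst v})"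

lemma adj_polarity_graph:
  "adj (polarity_graph k) u v \<longleftrightarrow>
    u \<in> gf2 k \<times> gf2 k \<and> v \<in> gf2 k \<times> gf2 k \<and> u \<noteq> v \<and> snd u + snd v = fst u * fst v"
  unfolding polarity_graph_def snd_conv mem_Collect_eq doubleton_eq_iff
  by (metis add.commute mult.commute)

lemma finite_gf2: "k \<ge> 1 \<Longrightarrow> finite (gf2 k)"
  by (rule card_ge_0_finite) (simp add: card_gf2)

lemma simple_polarity_graph: "k \<ge> 1 \<Longrightarrow> simple_graph (polarity_graph k)"
  using finite_gf2 by (auto simp: simple_graph_def polarity_graph_def)

lemma card_verts_polarity_graph:
  assumes "k \<ge> 1"
  shows "card (verts (polarity_graph k)) = (2 ^ k) ^ 2"
  by (simp add: polarity_graph_def card_cartesian_product card_gf2[OF assms] power2_eq_square)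

text \<open>The pairs \<open>u\<close>, \<open>w\<close> and \<open>v\<close>, \<open>z\<close> are
  the opposite vertices of the cycle.\<close>

lemma length_4_cycleE:
  assumes "is_cycle R p" "length p = 4" and sym: "\<And>x y. R x y \<Longrightarrow> R y x"
  obtains u v w z where "u \<noteq> w" "v \<noteq> z" "R u v" "R w v" "R u z" "R w z"
proof -
  obtain u v w z where "p = [u, v, w, z]"
    using assms(2) by (auto simp: length_Suc_conv numeral_eq_Suc)
  then show thesis
    using that[of u w v z] assms(1) sym by (auto simp: is_cycle_iff_successively)
qed

text \<open>Two lines share at most one point: subtracting the equations gives
  \<open>fst u = fst w\<close> or \<open>fst v = fst z\<close>, and then the second coordinates
  agree as well.\<close>

lemma polarity_graph_no_4_cycle: "\<nexists>p. is_cycle (adj (polarity_graph k)) p \<and> length p = 4"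
proof
  assume "\<exists>p. is_cycle (adj (polarity_graph k)) p \<and> length p = 4"
  then obtain p where "is_cycle (adj (polarity_graph k)) p" "length p = 4" by blast
  moreover have "adj (polarity_graph k) y x" if "adj (polarity_graph k) x y" for x y
    using that by (simp only: insert_commute)
  ultimately obtain u v w z where ne: "u \<noteq> w" "v \<noteq> z"
    and adj: "adj (polarity_graph k) u v" "adj (polarity_graph k) w v"
      "adj (polarity_graph k) u z" "adj (polarity_graph k) w z"
    by (rule length_4_cycleE)
  have e: "snd u + snd v = fst u * fst v" "snd w + snd v = fst w * fst v"
    "snd u + snd z = fst u * fst z" "snd w + snd z = fst w * fst z"
    using adj unfolding adj_polarity_graph by blast+
  have "snd u - snd w = (fst u - fst w) * fst v" "snd u - snd w = (fst u - fst w) * fst z"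
    using e by (simp_all add: left_diff_distrib flip: e)
  then have "fst u = fst w \<or> fst v = fst z" by auto
  then show False
  proof
    assume "fst u = fst w"
    then have "snd u = snd w" using e(1,2) by (metis add_right_cancel)
    then show False using \<open>fst u = fst w\<close> ne(1) by (simp add: prod_eq_iff)
  next
    assume "fst v = fst z"
    then have "snd v = snd z" using e(1,3) by (metis add_left_cancel)
    then show False using \<open>fst v = fst z\<close> ne(2) by (simp add: prod_eq_iff)
  qed
qed

lemma bit_alg_closure_add_eq_0_iff: "(x::bit alg_closure) + y = 0 \<longleftrightarrow> x = y"
  by (metis add_left_cancel bit_alg_closure_double)

text \<open>The left side counts the triples \<open>(a, b, c)\<close> with \<open>a\<close>,
  \<open>b\<close> distinct and nonzero. Each yields a triangle and can be recovered from that
  triangle and an ordered pair of its vertices, for which there are 9 choices.\<close>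

lemma polarity_graph_triangles:
  assumes k: "k \<ge> 1" and q: "q = (2::nat) ^ k"
  shows "q * (q - 1) * (q - 2) \<le> 9 * card (triangles (polarity_graph k))"
proof -
  let ?F = "gf2 k" and ?G = "polarity_graph k"
  define D where "D = (SIGMA a:?F - {0}. (SIGMA b:?F - {0, a}. ?F))"
  \<comment> \<open>The only point with first coordinate \<open>b\<close> that satisfies the
    adjacency equation with \<open>(a, c)\<close>.\<close>
  define pt where "pt a c b = (b, a * b + c)" for a b c :: "bit alg_closure"
  define tri where "tri = (\<lambda>(a, b, c). {(a, c), pt a c b, pt a c (a * b / (a + b))})"
  \<comment> \<open>Recording the vertices \<open>(a, c)\<close> and \<open>pt a c b\<close> besides
    the triangle makes injectivity immediate.\<close>
  define f where "f = (\<lambda>x. (tri x, (fst x, snd (snd x)), pt (fst x) (snd (snd x)) (fst (snd x))))"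
  have fin: "finite ?F" using finite_gf2[OF k] .
  have "0 \<in> ?F" by (simp add: gf2_def)
  have cF: "card ?F = q" using card_gf2[OF k] q by simp
  have "card D = (\<Sum>a\<in>?F - {0}. \<Sum>b\<in>?F - {0, a}. q)"
    unfolding D_def using fin cF by (simp add: card_SigmaI)
  also have "\<dots> = (\<Sum>a\<in>?F - {0}. (q - 2) * q)"
  proof (rule sum.cong[OF refl])
    fix a assume "a \<in> ?F - {0}"
    then have "card (?F - {0, a}) = q - 2"
      using \<open>0 \<in> ?F\<close> fin cF by (subst card_Diff_subset) auto
    then show "(\<Sum>b\<in>?F - {0, a}. q) = (q - 2) * q" by simp
  qed
  also have "\<dots> = q * (q - 1) * (q - 2)" using \<open>0 \<in> ?F\<close> cF by (simp add: mult_ac)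
  finally have card_D: "card D = q * (q - 1) * (q - 2)" .
  have "card D \<le> card (SIGMA T:triangles ?G. T \<times> T)"
  proof (rule card_inj_on_le[of f])
    show "inj_on f D"
      by (rule inj_onI) (auto simp: f_def pt_def)
    show "finite (SIGMA T:triangles ?G. T \<times> T)"
    proof (rule finite_SigmaI[OF finite_triangles[OF simple_polarity_graph[OF k]]])
      fix T assume "T \<in> triangles ?G"
      then have "T \<subseteq> ?F \<times> ?F" by (auto simp: triangles_def polarity_graph_def)
      then show "finite (T \<times> T)" using fin by (meson finite_SigmaI finite_subset)
    qed
    show "f ` D \<subseteq> (SIGMA T:triangles ?G. T \<times> T)"
    proof (rule image_subsetI)
      fix x assume "x \<in> D"
      then obtain a b c where x: "x = (a, b, c)" "(a, b, c) \<in> D" by (cases x) auto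
      then have F: "a \<in> ?F" "b \<in> ?F" "c \<in> ?F" and nz: "a \<noteq> 0" "b \<noteq> 0" "b \<noteq> a"
        by (auto simp: D_def)
      \<comment> \<open>In characteristic 2 the sum of the three adjacency equations of a triangle with first
        coordinates a, b, d reads ab + bd + da = 0, which determines d and leaves c free.\<close>
      define d where "d = a * b / (a + b)"
      have "a + b \<noteq> 0" using nz(3) bit_alg_closure_add_eq_0_iff[of a b] by simp
      then have d: "d * (a + b) = a * b" by (simp add: d_def)
      have "d \<in> ?F" unfolding d_def divide_inverse using F by (intro gf2_closed)
      have "d \<noteq> a"
      proof
        assume "d = a"
        then have "a * a = 0" using d by (simp add: distrib_left)
        then show False using nz by simp
      qed
      moreover have "d \<noteq> b"
      proof
        assume "d = b"
        then have "b * b = 0" using d by (simp add: distrib_left mult.commute)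
        then show False using nz by simp
      qed
      ultimately have dist: "(a, c) \<noteq> pt a c b" "(a, c) \<noteq> pt a c d" "pt a c b \<noteq> pt a c d"
        using nz by (auto simp: pt_def)
      have mem: "(a, c) \<in> ?F \<times> ?F" "pt a c b \<in> ?F \<times> ?F" "pt a c d \<in> ?F \<times> ?F"
        using F \<open>d \<in> ?F\<close> gf2_closed by (auto simp: pt_def)
      have cc: "c + (x + c) = x" for x
        by (metis add.left_commute add.right_neutral bit_alg_closure_double)
      have "a * b + c + (a * d + c) = a * b + a * d"
        using cc by (simp add: add.assoc)
      also have "\<dots> = d * a + d * b + d * a" using d by (simp add: distrib_left mult.commute)
      also have "\<dots> = b * d"
        using bit_alg_closure_double[of "d * a"] by (simp add: add.commute add.left_commute mult.commute)
      finally have e: "a * b + c + (a * d + c) = b * d" .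
      have adj: "adj ?G (a, c) (pt a c b)" "adj ?G (a, c) (pt a c d)" "adj ?G (pt a c b) (pt a c d)"
        unfolding adj_polarity_graph using mem dist e cc by (simp_all add: pt_def)
      have tri: "tri (a, b, c) = {(a, c), pt a c b, pt a c d}" by (simp add: tri_def d_def)
      have "tri (a, b, c) \<in> triangles ?G"
        unfolding triangles_def mem_Collect_eq
      proof (intro conjI ballI impI)
        show "tri (a, b, c) \<subseteq> verts ?G" using mem by (simp add: tri polarity_graph_def)
        show "card (tri (a, b, c)) = 3" using dist by (simp add: tri)
        fix x y assume "x \<in> tri (a, b, c)" "y \<in> tri (a, b, c)" "x \<noteq> y"
        then show "adj ?G x y" using adj unfolding tri by (auto simp only: insert_commute insert_iff empty_iff)
      qed
      then show "f x \<in> (SIGMA T:triangles ?G. T \<times> T)"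
        by (simp add: x f_def tri)
    qed
  qed
  also have "card (SIGMA T:triangles ?G. T \<times> T) = (\<Sum>T\<in>triangles ?G. card (T \<times> T))"
  proof (rule card_SigmaI[OF finite_triangles[OF simple_polarity_graph[OF k]]])
    show "\<forall>T\<in>triangles ?G. finite (T \<times> T)"
    proof
      fix T assume "T \<in> triangles ?G"
      then have "card T = 3" by (simp add: triangles_def)
      then have "finite T" by (metis card.infinite zero_neq_numeral)
      then show "finite (T \<times> T)" by simp
    qed
  qed
  also have "\<dots> = (\<Sum>T\<in>triangles ?G. 9)"
    by (rule sum.cong) (auto simp: triangles_def card_cartesian_product)
  finally show ?thesis by (simp add: card_D)
qed

section \<open>Counting paths of length two\<close>

text \<open>The witness \<open>m\<close> is the sum of the degrees. Without 4-cycles two distinct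
  vertices have at most one common neighbour, so the squared degrees sum to at most
  \<open>n ^ 2 + m\<close>. Leaving \<open>t\<close> free avoids square roots in the bound on
  \<open>m\<close>.\<close>

lemma no_4_cycle_edge_bound:
  assumes G: "simple_graph G" and free: "\<nexists>p. is_cycle (adj G) p \<and> length p = 4"
    and n: "n = card (verts G)"
  obtains m where "card (edges G) \<le> m" "\<And>t. 2 * t * m \<le> n ^ 2 + m + t ^ 2 * n"
proof -
  let ?V = "verts G"
  define N where "N v = {w \<in> ?V. adj G v w}" for v
  define m where "m = card (arcs_between (adj G) ?V ?V)"
  have fin: "finite ?V" using G by (simp add: simple_graph_def)
  have finN: "finite (N v)" for v using fin by (simp add: N_def)
  have irrefl: "\<not> adj G x x" for x using G by (auto simp: simple_graph_def)
  have arcs: "arcs_between (adj G) ?V ?V = (SIGMA v:?V. N v)" by (simp add: arcs_between_def N_def)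
  have m: "m = (\<Sum>v\<in>?V. card (N v))" unfolding m_def arcs using fin finN by simp
  have "edges G \<subseteq> (\<lambda>(x, y). {x, y}) ` arcs_between (adj G) ?V ?V"
  proof
    fix e assume e: "e \<in> edges G"
    then have "card e = 2" "e \<subseteq> ?V" using G by (auto simp: simple_graph_def)
    then obtain x y where "e = {x, y}" "x \<in> ?V" "y \<in> ?V" by (auto simp: card_2_iff)
    then show "e \<in> (\<lambda>(x, y). {x, y}) ` arcs_between (adj G) ?V ?V"
      using e by (auto simp: arcs_between_def intro!: rev_image_eqI[of "(x, y)"])
  qed
  then have le: "card (edges G) \<le> m"
    unfolding m_def by (rule surj_card_le[OF finite_arcs_between[OF fin fin]])
  \<comment> \<open>\<open>P\<close> consists of the paths of length two with middle
    \<open>v\<close>, and \<open>Q\<close> of the degenerate ones with equal ends. Two middles for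
    the same ends would give a 4-cycle.\<close>
  define P where "P = (SIGMA v:?V. {(x, y) \<in> N v \<times> N v. x \<noteq> y})"
  define Q where "Q = (SIGMA v:?V. {(x, y) \<in> N v \<times> N v. x = y})"
  have "card P \<le> card (?V \<times> ?V)"
  proof (rule card_inj_on_le[of snd])
    show "inj_on snd P"
    proof (rule inj_onI)
      fix r r' assume r: "r \<in> P" "r' \<in> P" "snd r = snd r'"
      obtain v x y v' where e: "r = (v, x, y)" "r' = (v', x, y)"
        using r(3) by (metis prod.collapse)
      have "v = v'"
      proof (rule ccontr)
        assume "v \<noteq> v'"
        then have "is_cycle (adj G) [v, x, v', y]"
          using r(1,2) irrefl unfolding e is_cycle_iff_successively P_def N_def
          by (auto simp: insert_commute)
        then show False using free by fastforce
      qed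
      then show "r = r'" using e by simp
    qed
  qed (auto simp: P_def N_def fin)
  also have "card (?V \<times> ?V) = n ^ 2" by (simp add: n power2_eq_square card_cartesian_product)
  finally have P: "card P \<le> n ^ 2" .
  have "card Q \<le> m"
    unfolding m_def arcs
    by (rule card_inj_on_le[of "\<lambda>(v, x, y). (v, x)"]) (auto simp: Q_def inj_on_def fin finN)
  have "(\<Sum>v\<in>?V. card (N v) ^ 2) = card (SIGMA v:?V. N v \<times> N v)"
    using fin finN by (simp add: card_SigmaI card_cartesian_product power2_eq_square)
  also have "(SIGMA v:?V. N v \<times> N v) = P \<union> Q" by (auto simp: P_def Q_def)
  also have "card (P \<union> Q) \<le> card P + card Q" by (rule card_Un_le)
  finally have sq: "(\<Sum>v\<in>?V. card (N v) ^ 2) \<le> n ^ 2 + m" using P \<open>card Q \<le> m\<close> by linarith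
  have "2 * t * m \<le> n ^ 2 + m + t ^ 2 * n" for t
  proof -
    \<comment> \<open>The tangent to the square at \<open>t\<close>, summed over all degrees, takes
      the place of the Cauchy-Schwarz inequality.\<close>
    have "2 * t * d \<le> d ^ 2 + t ^ 2" for d :: nat
    proof -
      have "real (2 * t * d) \<le> real (d ^ 2 + t ^ 2)"
        using sum_squares_bound[of "real t" "real d"] by (simp add: add.commute)
      then show ?thesis by (simp only: of_nat_le_iff)
    qed
    then have "(\<Sum>v\<in>?V. 2 * t * card (N v)) \<le> (\<Sum>v\<in>?V. card (N v) ^ 2 + t ^ 2)"
      by (rule sum_mono)
    then show ?thesis using sq by (simp add: m n sum.distrib sum_distrib_left mult.commute)
  qed
  then show thesis using that le by blast
qed

text \<open>Both sides are compared with \<open>q ^ 3\<close>, where \<open>q = 2 ^ k\<close> and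
  \<open>q ^ 2 \<le> n < 4 * q ^ 2\<close>: there are at most \<open>32 / 3 * q ^ 3\<close> edges,
  and the polarity graph gives at least \<open>q ^ 3 / 24\<close> triangles. The quotient of these
  constants is 256.\<close>

lemma many_triangles_without_4_cycles:
  assumes G: "simple_graph G" and free: "\<nexists>p. is_cycle (adj G) p \<and> length p = 4"
    and n: "n = card (verts G)" "n \<ge> 16"
  shows "card (edges G) \<le> 256 * ex_copies n (cycle_graph 3) {cycle_graph 4}"
proof -
  obtain k where k: "4 ^ k \<le> n" "n < 4 ^ (k + 1)"
    using ex_power_ivl1[of 4 n] n(2) by auto
  have "k \<ge> 2"
  proof (rule ccontr)
    assume "\<not> k \<ge> 2"
    then have "(4::nat) ^ (k + 1) \<le> 4 ^ 2" by (intro power_increasing) auto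
    then show False using k n by simp
  qed
  define q :: nat where "q = 2 ^ k"
  have q4: "q \<ge> 4" using power_increasing[OF \<open>k \<ge> 2\<close>, of "2::nat"] by (simp add: q_def)
  have "(4::nat) ^ k = q ^ 2" 
    by (simp add: q_def power2_eq_square flip: power_mult_distrib)
  then have qn: "q ^ 2 \<le> n" "n \<le> 4 * q ^ 2" using k by auto
  let ?ex = "ex_copies n (cycle_graph 3) {cycle_graph 4}"
  have "card (triangles (polarity_graph k)) \<le> ?ex"
    using \<open>k \<ge> 2\<close> qn card_verts_polarity_graph[of k] polarity_graph_no_4_cycle
    by (intro triangles_le_ex_copies simple_polarity_graph) (auto simp: q_def)
  then have "q * (q - 1) * (q - 2) \<le> 9 * ?ex"
    using polarity_graph_triangles[of k q] \<open>k \<ge> 2\<close> by (simp add: q_def)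
  \<comment> \<open>Here \<open>q \<ge> 4\<close>, the reason for \<open>n \<ge> 16\<close>, makes
    \<open>q - 1\<close> at least \<open>3 / 4 * q\<close> and \<open>q - 2\<close> at least
    \<open>q / 2\<close>.\<close>
  moreover have "q * ((3 * q) * q) \<le> q * ((4 * (q - 1)) * (2 * (q - 2)))"
  proof (rule mult_le_mono2[OF mult_le_mono])
    show "3 * q \<le> 4 * (q - 1)" "q \<le> 2 * (q - 2)" using q4 by auto
  qed
  moreover have "q * ((3 * q) * q) = 3 * q ^ 3" by (simp add: power3_eq_cube)
  moreover have "q * ((4 * (q - 1)) * (2 * (q - 2))) = 8 * (q * (q - 1) * (q - 2))" by simp
  ultimately have lower: "3 * q ^ 3 \<le> 72 * ?ex" by linarith
  \<comment> \<open>The choice \<open>t = 2 * q\<close>, just above the square root of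
    \<open>n\<close>, bounds both \<open>n ^ 2\<close> and \<open>t ^ 2 * n\<close> by
    \<open>16 * q ^ 4\<close>.\<close>
  obtain m where m: "card (edges G) \<le> m" "2 * (2 * q) * m \<le> n ^ 2 + m + (2 * q) ^ 2 * n"
    using no_4_cycle_edge_bound[OF G free n(1)] by blast
  have "n ^ 2 \<le> (4 * q ^ 2) ^ 2" using qn(2) by (rule power_mono) simp
  moreover have "(2 * q) ^ 2 * n \<le> (2 * q) ^ 2 * (4 * q ^ 2)" using qn(2) by (rule mult_le_mono2)
  moreover have "(4 * q ^ 2) ^ 2 = 16 * q ^ 4" "(2 * q) ^ 2 * (4 * q ^ 2) = 16 * q ^ 4"
    by (simp_all add: power2_eq_square power4_eq_xxxx)
  ultimately have "4 * q * m \<le> 32 * q ^ 4 + m" using m(2) by linarith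
  moreover have "m \<le> q * m" using q4 by simp
  ultimately have "3 * (q * m) \<le> 32 * q ^ 4" by linarith
  then have "q * (3 * m) \<le> q * (32 * q ^ 3)" by (simp add: power3_eq_cube power4_eq_xxxx mult_ac)
  then have "3 * m \<le> 32 * q ^ 3" using q4 by simp
  then show ?thesis using lower m(1) by linarith
qed

section \<open>Both bounds with their constants\<close>

theorem proposition1p1:
  "\<exists>c::real. c > 0 \<and> (\<forall>l::nat. l \<ge> 2 \<longrightarrow>
     (\<exists>N::nat. \<forall>n\<ge>N.
        c * real (ex_edges n {cycle_graph (2 * t) | t. 2 \<le> t \<and> t \<le> l})
          \<le> real (ex_copies n (cycle_graph 3) {cycle_graph (2 * l)})) \<and>
     (\<exists>C::real. C > 0 \<and> (\<forall>n\<ge>1.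
        real (ex_copies n (cycle_graph 3) {cycle_graph (2 * l)})
          \<le> C * real (ex_edges n {cycle_graph (2 * l)}))))"
proof (rule exI[of _ "1 / 256"], intro conjI allI impI)
  fix l :: nat assume l: "l \<ge> 2"
  let ?F = "{cycle_graph (2 * t) | t. 2 \<le> t \<and> t \<le> l}"
  \<comment> \<open>The factor 256 comes from \<open>l = 2\<close>; for larger \<open>l\<close> the
    factor 8 suffices, so one constant and the threshold 16 serve every \<open>l\<close>.\<close>
  have le: "ex_edges n ?F \<le> 256 * ex_copies n (cycle_graph 3) {cycle_graph (2 * l)}" if n: "n \<ge> 16" for n
  proof -
    have "edges F \<noteq> {}" if "F \<in> ?F" for F
      using that edges_cycle_graph_nonempty by auto
    then obtain G where G: "G \<in> free_graphs n ?F" and eq: "card (edges G) = ex_edges n ?F"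
      by (rule ex_edges_attained)
    have simple: "simple_graph G" and card: "card (verts G) = n"
      using G by (auto simp: free_graphs_def)
    have no_cycle: "\<nexists>p. is_cycle (adj G) p \<and> length p = 2 * t" if t: "2 \<le> t" "t \<le> l" for t
    proof -
      have "cycle_graph (2 * t) \<in> ?F" using t by blast
      moreover have "free_of ?F G" using G by (simp add: free_graphs_def)
      ultimately have "copies (cycle_graph (2 * t)) G = {}" unfolding free_of_def by blast
      then show ?thesis using copies_cycle_graph_empty_iff[OF simple, of "2 * t"] t by auto
    qed
    show ?thesis
    proof (cases "l = 2")
      case True
      then show ?thesis
        using many_triangles_without_4_cycles[OF simple _ card[symmetric] n] no_cycle[of 2] eq by simp
    next
      case False
      have "\<nexists>q. is_cycle (adj G) q \<and> even (length q) \<and> length q \<le> 2 * l"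
      proof
        assume "\<exists>q. is_cycle (adj G) q \<and> even (length q) \<and> length q \<le> 2 * l"
        then obtain q t where q: "is_cycle (adj G) q" "length q = 2 * t" "length q \<le> 2 * l"
          by (auto elim: evenE)
        moreover have "length q \<ge> 3" using q(1) by (simp add: is_cycle_def)
        ultimately show False using no_cycle[of t] by auto
      qed
      then have "card (edges G) \<le> 8 * ex_copies (card (verts G)) (cycle_graph 3) {cycle_graph (2 * l)}"
        using n card l False by (intro many_triangles_from_high_girth simple) auto
      then show ?thesis using eq card by simp
    qed
  qed
  show "\<exists>N. \<forall>n\<ge>N. 1 / 256 * real (ex_edges n ?F)
      \<le> real (ex_copies n (cycle_graph 3) {cycle_graph (2 * l)})"
  proof (intro exI[of _ 16] allI impI)
    fix n :: nat assume "n \<ge> 16"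
    then have "real (ex_edges n ?F) \<le> real (256 * ex_copies n (cycle_graph 3) {cycle_graph (2 * l)})"
      using le by (simp only: of_nat_le_iff)
    then show "1 / 256 * real (ex_edges n ?F) \<le> real (ex_copies n (cycle_graph 3) {cycle_graph (2 * l)})"
      by simp
  qed
  \<comment> \<open>The constant is the cycle length \<open>2 * l\<close>, the number of triangles
    charged to each deleted edge.\<close>
  have "real (ex_copies n (cycle_graph 3) {cycle_graph (2 * l)})
      \<le> real (2 * l) * real (ex_edges n {cycle_graph (2 * l)})" for n
    using ex_copies_le[of "2 * l" n] l by (simp flip: of_nat_mult)
  then show "\<exists>C::real. C > 0 \<and> (\<forall>n\<ge>1. real (ex_copies n (cycle_graph 3) {cycle_graph (2 * l)})
      \<le> C * real (ex_edges n {cycle_graph (2 * l)}))"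
    using l by (intro exI[of _ "real (2 * l)"]) auto
qed simp

end
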